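(* 1. The topological Lie algebra $\widehat{\mathfrak{u}}_\infty$ is an open uniserial, closed uniserial, open almost Artinian and closed almost Artinian Lie algebra which is neither open nor closed Artinian and is neither open nor closed Noetherian. 2. The uniserial dimensions of the set of open ideals and of the set of closed ideals of $\widehat{\mathfrak{u}}_\infty$ coincide and are equal to $\mathrm{u.dim}(\widehat{\mathfrak{u}}_\infty)=\omega^\omega$. 3. All the open ideals and all the closed ideals of $\widehat{\mathfrak{u}}_\infty$ are topologically characteristic ideals.
   Context: $K$ is a field of characteristic zero, $P_0=K$, $P_i=K[x_1,\ldots,x_i]$, $\partial_i=\partial/\partial x_i$. $\widehat{\mathfrak{u}}_\infty=\{\sum_{i\ge 1}a_i\partial_i\mid a_i\in P_{i-1}\}$ is the Lie algebra of infinite formal sums, with the bracket extending that of $\mathfrak{u}_\infty=\bigoplus_{i\ge 1}P_{i-1}\partial_i$ (triangular polynomial derivations). It is a topological Lie algebra in which the sets $a+\widehat{\mathfrak{u}}_{\infty,n}$ ($a\in\widehat{\mathfrak{u}}_\infty$, $n\ge 1$), with $\widehat{\mathfrak{u}}_{\infty,n}=\{\sum_{i\ge n}a_i\partial_i\mid a_i\in P_{i-1}\}$, form a basis of open sets. A topological Lie algebra $\mathcal{G}$ is open (resp. closed) uniserial if the set of its open (resp. closed) ideals is totally ordered by inclusion; open (resp. closed) Artinian if its open (resp. closed) ideals satisfy the descending chain condition; open (resp. closed) Noetherian if its open (resp. closed) ideals satisfy the ascending chain condition; open (resp. closed) almost Artinian if for every nonzero open (resp. closed) ideal $I$ the Lie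 algebra $\mathcal{G}/I$ is Artinian (i.e. satisfies the descending chain condition on ideals). The uniserial dimension of a partially ordered set $S$ is the supremum of the order types of the subsets of $S$ that are totally ordered and in which every nonempty subset has a least element; sets of ideals are ordered by inclusion. $\omega$ is the first infinite ordinal. An ideal $I$ of $\mathcal{G}$ is topologically characteristic if $\sigma(I)=I$ for every $\sigma:\mathcal{G}\to\mathcal{G}$ that is both an automorphism of the Lie algebra $\mathcal{G}$ and a homeomorphism. *)

theory Defs
  imports "HOL-Library.Poly_Mapping" "HOL-Analysis.Analysis"
begin

unbundle cardinal_syntax

section \<open>Lie algebras and topological Lie algebras\<close>

record ('k, 'a) lie_alg =
  lcarrier :: "'a set"
  lzero :: 'a
  ladd :: "'a \<Rightarrow> 'a \<Rightarrow> 'a"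
  lscale :: "'k \<Rightarrow> 'a \<Rightarrow> 'a"
  lbracket :: "'a \<Rightarrow> 'a \<Rightarrow> 'a"

record ('k, 'a) top_lie_alg = "('k, 'a) lie_alg" +
  ltopology :: "'a topology"

locale lie_algebra =
  fixes G :: "('k::field, 'a, 'z) lie_alg_scheme"
  assumes zero_closed: "lzero G \<in> lcarrier G"
    and add_closed: "\<lbrakk>x \<in> lcarrier G; y \<in> lcarrier G\<rbrakk> \<Longrightarrow> ladd G x y \<in> lcarrier G"
    and scale_closed: "x \<in> lcarrier G \<Longrightarrow> lscale G c x \<in> lcarrier G"
    and bracket_closed: "\<lbrakk>x \<in> lcarrier G; y \<in> lcarrier G\<rbrakk> \<Longrightarrow> lbracket G x y \<in> lcarrier G"
    and add_assoc: "\<lbrakk>x \<in> lcarrier G; y \<in> lcarrier G; z \<in> lcarrier G\<rbrakk>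
      \<Longrightarrow> ladd G (ladd G x y) z = ladd G x (ladd G y z)"
    and add_commute: "\<lbrakk>x \<in> lcarrier G; y \<in> lcarrier G\<rbrakk> \<Longrightarrow> ladd G x y = ladd G y x"
    and add_zero: "x \<in> lcarrier G \<Longrightarrow> ladd G x (lzero G) = x"
    and add_inverse: "x \<in> lcarrier G \<Longrightarrow> \<exists>y\<in>lcarrier G. ladd G x y = lzero G"
    and scale_add_right: "\<lbrakk>x \<in> lcarrier G; y \<in> lcarrier G\<rbrakk>
      \<Longrightarrow> lscale G c (ladd G x y) = ladd G (lscale G c x) (lscale G c y)"
    and scale_add_left: "x \<in> lcarrier G
      \<Longrightarrow> lscale G (c + d) x = ladd G (lscale G c x) (lscale G d x)"
    and scale_scale: "x \<in> lcarrier G \<Longrightarrow> lscale G c (lscale G d x) = lscale G (c * d) x"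
    and scale_one: "x \<in> lcarrier G \<Longrightarrow> lscale G 1 x = x"
    and bracket_add_left: "\<lbrakk>x \<in> lcarrier G; y \<in> lcarrier G; z \<in> lcarrier G\<rbrakk>
      \<Longrightarrow> lbracket G (ladd G x y) z = ladd G (lbracket G x z) (lbracket G y z)"
    and bracket_add_right: "\<lbrakk>x \<in> lcarrier G; y \<in> lcarrier G; z \<in> lcarrier G\<rbrakk>
      \<Longrightarrow> lbracket G x (ladd G y z) = ladd G (lbracket G x y) (lbracket G x z)"
    and bracket_scale_left: "\<lbrakk>x \<in> lcarrier G; y \<in> lcarrier G\<rbrakk>
      \<Longrightarrow> lbracket G (lscale G c x) y = lscale G c (lbracket G x y)"
    and bracket_scale_right: "\<lbrakk>x \<in> lcarrier G; y \<in> lcarrier G\<rbrakk>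
      \<Longrightarrow> lbracket G x (lscale G c y) = lscale G c (lbracket G x y)"
    and bracket_self: "x \<in> lcarrier G \<Longrightarrow> lbracket G x x = lzero G"
    and jacobi: "\<lbrakk>x \<in> lcarrier G; y \<in> lcarrier G; z \<in> lcarrier G\<rbrakk>
      \<Longrightarrow> ladd G (lbracket G x (lbracket G y z))
            (ladd G (lbracket G y (lbracket G z x)) (lbracket G z (lbracket G x y))) = lzero G"

text \<open>The ground field is taken with the discrete topology, so continuity of the scalar
  multiplication is continuity of each homothety.\<close>

locale topological_lie_algebra = lie_algebra G
  for G :: "('k::field, 'a, 'z) top_lie_alg_scheme" +
  assumes topspace_eq: "topspace (ltopology G) = lcarrier G"
    and continuous_add: "continuous_map (prod_topology (ltopology G) (ltopology G)) (ltopology G)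
      (\<lambda>(x, y). ladd G x y)"
    and continuous_scale: "continuous_map (ltopology G) (ltopology G) (lscale G c)"
    and continuous_bracket: "continuous_map (prod_topology (ltopology G) (ltopology G))
      (ltopology G) (\<lambda>(x, y). lbracket G x y)"

definition lie_ideal :: "('k, 'a, 'z) lie_alg_scheme \<Rightarrow> 'a set \<Rightarrow> bool" where
  "lie_ideal G I \<longleftrightarrow> I \<subseteq> lcarrier G \<and> lzero G \<in> I
    \<and> (\<forall>x\<in>I. \<forall>y\<in>I. ladd G x y \<in> I)
    \<and> (\<forall>c. \<forall>x\<in>I. lscale G c x \<in> I)
    \<and> (\<forall>g\<in>lcarrier G. \<forall>x\<in>I. lbracket G g x \<in> I)"

definition ideals :: "('k, 'a, 'z) lie_alg_scheme \<Rightarrow> 'a set set" where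
  "ideals G = {I. lie_ideal G I}"

definition open_ideals :: "('k, 'a, 'z) top_lie_alg_scheme \<Rightarrow> 'a set set" where
  "open_ideals G = {I. lie_ideal G I \<and> openin (ltopology G) I}"

definition closed_ideals :: "('k, 'a, 'z) top_lie_alg_scheme \<Rightarrow> 'a set set" where
  "closed_ideals G = {I. lie_ideal G I \<and> closedin (ltopology G) I}"

definition lie_coset :: "('k, 'a, 'z) lie_alg_scheme \<Rightarrow> 'a set \<Rightarrow> 'a \<Rightarrow> 'a set" where
  "lie_coset G I x = ladd G x ` I"

text \<open>The operations on cosets are the unions of the cosets obtained from all representatives;
  when \<open>I\<close> is an ideal these cosets all coincide.\<close>

definition lie_quotient :: "('k, 'a, 'z) lie_alg_scheme \<Rightarrow> 'a set \<Rightarrow> ('k, 'a set) lie_alg" where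
  "lie_quotient G I =
    \<lparr> lcarrier = lie_coset G I ` lcarrier G,
      lzero = I,
      ladd = (\<lambda>A B. \<Union>a\<in>A. \<Union>b\<in>B. lie_coset G I (ladd G a b)),
      lscale = (\<lambda>c A. \<Union>a\<in>A. lie_coset G I (lscale G c a)),
      lbracket = (\<lambda>A B. \<Union>a\<in>A. \<Union>b\<in>B. lie_coset G I (lbracket G a b)) \<rparr>"

definition lie_automorphism :: "('k, 'a, 'z) lie_alg_scheme \<Rightarrow> ('a \<Rightarrow> 'a) \<Rightarrow> bool" where
  "lie_automorphism G \<sigma> \<longleftrightarrow> bij_betw \<sigma> (lcarrier G) (lcarrier G)
    \<and> (\<forall>x\<in>lcarrier G. \<forall>y\<in>lcarrier G. \<sigma> (ladd G x y) = ladd G (\<sigma> x) (\<sigma> y))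
    \<and> (\<forall>c. \<forall>x\<in>lcarrier G. \<sigma> (lscale G c x) = lscale G c (\<sigma> x))
    \<and> (\<forall>x\<in>lcarrier G. \<forall>y\<in>lcarrier G. \<sigma> (lbracket G x y) = lbracket G (\<sigma> x) (\<sigma> y))"

definition topologically_characteristic ::
    "('k, 'a, 'z) top_lie_alg_scheme \<Rightarrow> 'a set \<Rightarrow> bool" where
  "topologically_characteristic G I \<longleftrightarrow> lie_ideal G I
    \<and> (\<forall>\<sigma>. lie_automorphism G \<sigma> \<and> homeomorphic_map (ltopology G) (ltopology G) \<sigma>
        \<longrightarrow> \<sigma> ` I = I)"


section \<open>Chain conditions\<close>

definition totally_ordered :: "'p::order set \<Rightarrow> bool" where
  "totally_ordered S \<longleftrightarrow> (\<forall>x\<in>S. \<forall>y\<in>S. x \<le> y \<or> y \<le> x)"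

definition dcc :: "'p::order set \<Rightarrow> bool" where
  "dcc S \<longleftrightarrow> (\<forall>f::nat \<Rightarrow> 'p. (\<forall>n. f n \<in> S) \<and> (\<forall>n. f (Suc n) \<le> f n)
    \<longrightarrow> (\<exists>N. \<forall>n\<ge>N. f n = f N))"

definition acc :: "'p::order set \<Rightarrow> bool" where
  "acc S \<longleftrightarrow> (\<forall>f::nat \<Rightarrow> 'p. (\<forall>n. f n \<in> S) \<and> (\<forall>n. f n \<le> f (Suc n))
    \<longrightarrow> (\<exists>N. \<forall>n\<ge>N. f n = f N))"

definition artinian :: "('k, 'a, 'z) lie_alg_scheme \<Rightarrow> bool" where
  "artinian G \<longleftrightarrow> dcc (ideals G)"

definition open_uniserial :: "('k, 'a, 'z) top_lie_alg_scheme \<Rightarrow> bool" where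
  "open_uniserial G \<longleftrightarrow> totally_ordered (open_ideals G)"

definition closed_uniserial :: "('k, 'a, 'z) top_lie_alg_scheme \<Rightarrow> bool" where
  "closed_uniserial G \<longleftrightarrow> totally_ordered (closed_ideals G)"

definition open_artinian :: "('k, 'a, 'z) top_lie_alg_scheme \<Rightarrow> bool" where
  "open_artinian G \<longleftrightarrow> dcc (open_ideals G)"

definition closed_artinian :: "('k, 'a, 'z) top_lie_alg_scheme \<Rightarrow> bool" where
  "closed_artinian G \<longleftrightarrow> dcc (closed_ideals G)"

definition open_noetherian :: "('k, 'a, 'z) top_lie_alg_scheme \<Rightarrow> bool" where
  "open_noetherian G \<longleftrightarrow> acc (open_ideals G)"

definition closed_noetherian :: "('k, 'a, 'z) top_lie_alg_scheme \<Rightarrow> bool" where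
  "closed_noetherian G \<longleftrightarrow> acc (closed_ideals G)"

definition open_almost_artinian :: "('k, 'a, 'z) top_lie_alg_scheme \<Rightarrow> bool" where
  "open_almost_artinian G \<longleftrightarrow>
    (\<forall>I\<in>open_ideals G. I \<noteq> {lzero G} \<longrightarrow> artinian (lie_quotient G I))"

definition closed_almost_artinian :: "('k, 'a, 'z) top_lie_alg_scheme \<Rightarrow> bool" where
  "closed_almost_artinian G \<longleftrightarrow>
    (\<forall>I\<in>closed_ideals G. I \<noteq> {lzero G} \<longrightarrow> artinian (lie_quotient G I))"


section \<open>Uniserial dimension\<close>

text \<open>Ordinals are represented by well-orders in the sense of \<open>Well_order\<close>, compared by
  \<open>\<le>o\<close>; the order type of a subset \<open>C\<close> of a partially ordered type is represented by
  the induced relation on \<open>C\<close>.\<close>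

definition well_ordered_subset :: "'p::order set \<Rightarrow> bool" where
  "well_ordered_subset C \<longleftrightarrow> totally_ordered C
    \<and> (\<forall>D. D \<subseteq> C \<and> D \<noteq> {} \<longrightarrow> (\<exists>m\<in>D. \<forall>d\<in>D. m \<le> d))"

definition induced_order :: "'p::order set \<Rightarrow> 'p rel" where
  "induced_order C = {(x, y). x \<in> C \<and> y \<in> C \<and> x \<le> y}"

definition bounds_order_types :: "'p::order set \<Rightarrow> 'b rel \<Rightarrow> bool" where
  "bounds_order_types S r \<longleftrightarrow> Well_order r
    \<and> (\<forall>C. C \<subseteq> S \<and> well_ordered_subset C \<longrightarrow> induced_order C \<le>o r)"

text \<open>\<open>has_udim S r\<close>: the ordinal \<open>r\<close> is the supremum of the order types of the well-ordered
  subsets of \<open>S\<close>. It suffices to compare \<open>r\<close> with upper bounds living on the same type: an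
  upper bound on another type that is strictly smaller than \<open>r\<close> is isomorphic to a proper
  initial segment of \<open>r\<close>.\<close>

definition has_udim :: "'p::order set \<Rightarrow> 'b rel \<Rightarrow> bool" where
  "has_udim S r \<longleftrightarrow> bounds_order_types S r
    \<and> (\<forall>r'::'b rel. bounds_order_types S r' \<longrightarrow> r \<le>o r')"

text \<open>The ordinal \<open>\<omega>\<^sup>\<omega>\<close>: finitely supported functions from \<open>\<omega>\<close> to \<open>\<omega>\<close>, compared at the
  largest argument where they differ. The function \<open>f\<close> stands for the Cantor normal form
  \<open>\<Sum>\<^sub>k \<omega>\<^sup>k \<cdot> f k\<close> (decreasing in \<open>k\<close>).\<close>

definition omega_pow_omega :: "(nat \<Rightarrow>\<^sub>0 nat) rel" where
  "omega_pow_omega = {(f, g). f = g \<or>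
    (\<exists>k. Poly_Mapping.lookup f k < Poly_Mapping.lookup g k
      \<and> (\<forall>j>k. Poly_Mapping.lookup f j = Poly_Mapping.lookup g j))}"


section \<open>The Lie algebra of infinite sums of triangular derivations\<close>

text \<open>Polynomials in \<open>x\<^sub>0, x\<^sub>1, \<dots>\<close>: finitely supported functions from monomials (exponent
  vectors) to coefficients. The variable \<open>x\<^sub>0\<close> is never used.\<close>

type_synonym 'k mpoly = "(nat \<Rightarrow>\<^sub>0 nat) \<Rightarrow>\<^sub>0 'k"

text \<open>\<open>poly_upto i\<close> is \<open>K[x\<^sub>1, \<dots>, x\<^sub>i]\<close>.\<close>

definition poly_upto :: "nat \<Rightarrow> 'k::field_char_0 mpoly set" where
  "poly_upto i = {p. \<forall>m\<in>Poly_Mapping.keys p. Poly_Mapping.keys m \<subseteq> {1..i}}"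

text \<open>In the next definition a monomial \<open>m\<close> not involving \<open>x\<^sub>i\<close> contributes \<open>0\<close>, since its
  exponent of \<open>x\<^sub>i\<close> vanishes.\<close>

definition pderiv_var :: "nat \<Rightarrow> 'k::field_char_0 mpoly \<Rightarrow> 'k mpoly" where
  "pderiv_var i p = (\<Sum>m\<in>Poly_Mapping.keys p.
    Poly_Mapping.single (m - Poly_Mapping.single i 1)
      (of_nat (Poly_Mapping.lookup m i) * Poly_Mapping.lookup p m))"

text \<open>The formal sum \<open>\<Sum>\<^sub>i\<^sub>\<ge>\<^sub>1 a\<^sub>i \<partial>\<^sub>i\<close> is the sequence \<open>a\<close> of its coefficients; the meaningless
  entry \<open>a 0\<close> is normalised to \<open>0\<close>.\<close>

definition u_hat_carrier :: "(nat \<Rightarrow> 'k::field_char_0 mpoly) set" where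
  "u_hat_carrier = {a. a 0 = 0 \<and> (\<forall>i\<ge>1. a i \<in> poly_upto (i - 1))}"

definition u_hat_from :: "nat \<Rightarrow> (nat \<Rightarrow> 'k::field_char_0 mpoly) set" where
  "u_hat_from n = {a \<in> u_hat_carrier. \<forall>i<n. a i = 0}"

definition u_hat_add ::
    "(nat \<Rightarrow> 'k::field_char_0 mpoly) \<Rightarrow> (nat \<Rightarrow> 'k mpoly) \<Rightarrow> (nat \<Rightarrow> 'k mpoly)" where
  "u_hat_add a b = (\<lambda>i. a i + b i)"

definition u_hat_scale ::
    "'k::field_char_0 \<Rightarrow> (nat \<Rightarrow> 'k mpoly) \<Rightarrow> (nat \<Rightarrow> 'k mpoly)" where
  "u_hat_scale c a = (\<lambda>i. Poly_Mapping.single 0 c * a i)"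

text \<open>The commutator of the derivations \<open>\<Sum>\<^sub>i a\<^sub>i \<partial>\<^sub>i\<close> and \<open>\<Sum>\<^sub>i b\<^sub>i \<partial>\<^sub>i\<close>. Its \<open>k\<close>-th coefficient is
  a finite sum, because \<open>a\<^sub>k\<close> and \<open>b\<^sub>k\<close> only involve \<open>x\<^sub>i\<close> with \<open>i < k\<close>.\<close>

definition u_hat_bracket ::
    "(nat \<Rightarrow> 'k::field_char_0 mpoly) \<Rightarrow> (nat \<Rightarrow> 'k mpoly) \<Rightarrow> (nat \<Rightarrow> 'k mpoly)" where
  "u_hat_bracket a b = (\<lambda>k. \<Sum>i\<in>{1..<k}. a i * pderiv_var i (b k) - b i * pderiv_var i (a k))"

definition u_hat_basis :: "(nat \<Rightarrow> 'k::field_char_0 mpoly) set set" where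
  "u_hat_basis = {u_hat_add a ` u_hat_from n | a n. a \<in> u_hat_carrier \<and> n \<ge> 1}"

definition u_hat_topology :: "(nat \<Rightarrow> 'k::field_char_0 mpoly) topology" where
  "u_hat_topology = topology (arbitrary union_of (\<lambda>B. B \<in> u_hat_basis))"

definition u_hat :: "'k itself \<Rightarrow> ('k::field_char_0, nat \<Rightarrow> 'k mpoly) top_lie_alg" where
  "u_hat _ =
    \<lparr> lcarrier = u_hat_carrier,
      lzero = (\<lambda>_. 0),
      ladd = u_hat_add,
      lscale = u_hat_scale,
      lbracket = u_hat_bracket,
      ltopology = u_hat_topology \<rparr>"

end

theory Submission
  imports Defs "HOL-Library.Multiset_Order"
begin

text \<open>
  Give a nonzero element \<open>a = \<Sum> a\<^sub>i \<partial>\<^sub>i\<close> the leading term \<open>(n, b)\<close>, where \<open>a\<^sub>n\<close> is the first nonzero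
  coefficient and \<open>b\<close> is the largest monomial of \<open>a\<^sub>n\<close> in the lexicographic order in which the variable of
  largest index counts most. Everything rests on one fact (\<open>segment_subset_ideal\<close>): an ideal
  that contains \<open>a\<close> contains the whole \<open>segment n b\<close> of elements whose leading term is at most
  \<open>(n, b)\<close>, where a larger \<open>n\<close> counts as smaller. There are two reasons. Bracketing with \<open>x\<^sup>c \<partial>\<^sub>k\<close>, where \<open>c\<close>
  only involves variables of index less than \<open>k\<close>, turns the leading monomial \<open>b\<close> into
  \<open>x\<^sup>c \<cdot> b / x\<^sub>k\<close>; such steps lead from \<open>b\<close> to every smaller monomial
  (\<open>lead_term_below\<close>), in particular to an element
  \<open>D = \<partial>\<^sub>n + \<dots>\<close> of the ideal. And \<open>ad D\<close> maps the space of elements with coefficients only beyond \<open>n\<close>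
  onto itself (\<open>ad_surj\<close>), because \<open>D\<close> is surjective on polynomials: up to smaller monomials it is
  \<open>\<partial>\<^sub>n\<close>, which is inverted by integration.

  Each segment is an ideal, so the ideals form a chain whose levels \<open>n\<close> look like the ordinals up to
  \<open>\<omega>\<close> to the power \<open>n - 1\<close>, with larger \<open>n\<close> further down. This gives all the claims.
  The segments are linearly ordered, hence so are the ideals (\<open>hat_ideals_total\<close>).
  Every nonzero ideal contains all elements beyond some index, so it is open and closed, and the
  closed ideals are all the ideals while the open ones are the nonzero ones.
  Above a nonzero ideal only finitely many levels remain, and encoding level and monomial in one
  element of \<open>\<omega>\<^sup>\<omega>\<close> shows that the ideals there are well-ordered (\<open>wf_ideals_above\<close>), of order type
  below \<open>\<omega>\<^sup>\<omega>\<close>; a well-ordered set of ideals has a least nonzero member (if it has any), so \<open>\<omega>\<^sup>\<omega>\<close> bounds its order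
  type, and as level \<open>n\<close> contains \<open>\<omega>\<close> to the power \<open>n - 1\<close>, no smaller ordinal does
  (\<open>has_udim_u_hat\<close>). The infinitely many levels violate the descending
  chain condition, and level \<open>2\<close> already violates the ascending one.
  Finally, the elements supported from \<open>n + 1\<close> on are exactly the brackets of elements supported from \<open>n\<close> on,
  so every automorphism preserves these ideals; between them it acts on a well-ordered set of ideals,
  and an order automorphism of a well-ordered set is the identity (\<open>hat_ideal_characteristic\<close>).
\<close>

text \<open>Otherwise the simplifier rewrites the exponent vector \<open>single i 1\<close> of \<open>x\<^sub>i\<close> to \<open>single i (Suc 0)\<close>.\<close>

declare One_nat_def [simp del]

section \<open>The lexicographic order on monomials\<close>

abbreviation exponent :: "(nat \<Rightarrow>\<^sub>0 nat) \<Rightarrow> nat \<Rightarrow> nat" where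
  "exponent \<equiv> Poly_Mapping.lookup"

abbreviation expo :: "nat \<Rightarrow> nat \<Rightarrow>\<^sub>0 nat" where
  "expo i \<equiv> Poly_Mapping.single i 1"

text \<open>The order of \<open>omega_pow_omega\<close>, read on the exponent vectors of monomials.\<close>

definition mono_less :: "(nat \<Rightarrow>\<^sub>0 nat) \<Rightarrow> (nat \<Rightarrow>\<^sub>0 nat) \<Rightarrow> bool"  (infix \<open>\<sqsubset>\<close> 50) where
  "f \<sqsubset> g \<longleftrightarrow> (\<exists>k. exponent f k < exponent g k \<and> (\<forall>j>k. exponent f j = exponent g j))"

abbreviation mono_le :: "(nat \<Rightarrow>\<^sub>0 nat) \<Rightarrow> (nat \<Rightarrow>\<^sub>0 nat) \<Rightarrow> bool"  (infix \<open>\<sqsubseteq>\<close> 50) where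
  "f \<sqsubseteq> g \<equiv> f = g \<or> f \<sqsubset> g"

lemma omega_pow_omega_alt: "omega_pow_omega = {(f, g). f \<sqsubseteq> g}"
  by (auto simp: omega_pow_omega_def mono_less_def)

lemma mono_lessI:
  assumes "exponent f k < exponent g k" "\<And>j. j > k \<Longrightarrow> exponent f j = exponent g j"
  shows "f \<sqsubset> g"
  using assms unfolding mono_less_def by blast

lemma mono_less_irrefl [simp]: "\<not> f \<sqsubset> f"
  by (auto simp: mono_less_def)

lemma mono_less_trans:
  assumes "f \<sqsubset> g" "g \<sqsubset> h"
  shows "f \<sqsubset> h"
proof -
  obtain k where k: "exponent f k < exponent g k" "\<And>j. j > k \<Longrightarrow> exponent f j = exponent g j"
    using assms(1) unfolding mono_less_def by blast
  obtain l where l: "exponent g l < exponent h l" "\<And>j. j > l \<Longrightarrow> exponent g j = exponent h j"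
    using assms(2) unfolding mono_less_def by blast
  show ?thesis
  proof (rule mono_lessI[where k = "max k l"])
    show "exponent f (max k l) < exponent h (max k l)"
      using k l by (cases k l rule: linorder_cases) (auto simp: max_def)
  qed (use k l in auto)
qed

lemma mono_less_asym: "f \<sqsubset> g \<Longrightarrow> \<not> g \<sqsubset> f"
  using mono_less_trans mono_less_irrefl by blast

lemma mono_less_linear: "f \<sqsubset> g \<or> f = g \<or> g \<sqsubset> f"
proof (cases "f = g")
  case False
  define D where "D = {k. exponent f k \<noteq> exponent g k}"
  have "D \<subseteq> Poly_Mapping.keys f \<union> Poly_Mapping.keys g"
    by (auto simp: D_def in_keys_iff)
  hence fin: "finite D"
    by (rule finite_subset) simp
  have ne: "D \<noteq> {}"
    using False by (auto simp: D_def intro: poly_mapping_eqI)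
  have eq: "exponent f j = exponent g j" if "j > Max D" for j
    using Max_ge[OF fin, of j] that by (force simp: D_def)
  have "exponent f (Max D) \<noteq> exponent g (Max D)"
    using Max_in[OF fin ne] by (simp add: D_def)
  thus ?thesis
    using eq mono_lessI[of f "Max D" g] mono_lessI[of g "Max D" f] by (metis nat_neq_iff)
qed simp

lemma zero_mono_le: "0 \<sqsubseteq> f"
  using mono_less_linear[of 0 f] by (auto simp: mono_less_def)

lemma not_mono_less_zero [simp]: "\<not> f \<sqsubset> 0"
  by (auto simp: mono_less_def)

text \<open>A monomial is the multiset of its variables, and \<open>\<sqsubset>\<close> is then the multiset order: over a
  total order, the multiset order compares multiplicities at the largest element where they
  differ. So well-foundedness is that of the multiset order over the natural numbers.\<close>

lemma wf_mono_less: "wf {(f, g). f \<sqsubset> g}"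
proof -
  define M where "M f = Abs_multiset (exponent f)" for f
  have count_M: "count (M f) = exponent f" for f
    unfolding M_def by (rule count_Abs_multiset) (simp add: finite_lookup_nat)
  have less: "M f < M g" if fg: "f \<sqsubset> g" for f g
  proof -
    obtain k where k: "exponent f k < exponent g k" "\<And>j. j > k \<Longrightarrow> exponent f j = exponent g j"
      using fg unfolding mono_less_def by blast
    have "\<exists>x>y. exponent f x < exponent g x" if "exponent g y < exponent f y" for y
      using k that by (metis linorder_neqE_nat order_less_asym)
    moreover have "M f \<noteq> M g"
      using k(1) count_M by (metis nat_neq_iff)
    ultimately show ?thesis
      unfolding less_multiset\<^sub>H\<^sub>O by (auto simp: count_M)
  qed
  have "wf {(A, B :: nat multiset). A < B}"
    using wfp_less_multiset[where 'a = nat] by (simp add: wfp_def[symmetric])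
  hence "wf (inv_image {(A, B :: nat multiset). A < B} M)"
    by (rule wf_inv_image)
  thus ?thesis
    by (rule wf_subset) (use less in \<open>auto simp: inv_image_def\<close>)
qed

lemma mono_less_induct [consumes 0, case_names less]:
  assumes "\<And>b. (\<And>a. a \<sqsubset> b \<Longrightarrow> P a) \<Longrightarrow> P b"
  shows "P b"
  using wf_induct_rule[OF wf_mono_less, of P b] assms by blast

lemma ex_least_mono:
  assumes "A \<noteq> {}"
  shows "\<exists>a\<in>A. \<forall>b\<in>A. a \<sqsubseteq> b"
proof -
  obtain a where a: "a \<in> A" "\<And>b. b \<sqsubset> a \<Longrightarrow> b \<notin> A"
    using wfE_min[OF wf_mono_less, of _ A] assms by (metis CollectI case_prodI ex_in_conv)
  with mono_less_linear show ?thesis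
    by metis
qed

lemma ex_greatest_mono:
  assumes "finite A" "A \<noteq> {}"
  shows "\<exists>a\<in>A. \<forall>b\<in>A. b \<sqsubseteq> a"
  using assms
proof (induction rule: finite_ne_induct)
  case (insert x F)
  then obtain a where a: "a \<in> F" "\<forall>b\<in>F. b \<sqsubseteq> a"
    by blast
  then show ?case
    using mono_less_linear[of a x] mono_less_trans by (metis insert_iff)
qed simp

lemma mono_less_add_right [simp]: "f + h \<sqsubset> g + h \<longleftrightarrow> f \<sqsubset> g"
  by (simp add: mono_less_def lookup_add)

lemma diff_expo_add_expo: "exponent f i > 0 \<Longrightarrow> f - expo i + expo i = f"
  by (rule poly_mapping_eqI) (auto simp: lookup_add lookup_minus lookup_single when_def)

text \<open>Dividing by \<open>x\<^sub>i\<close> outweighs multiplying by any monomial in the variables before it: this is why the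
  derivations \<open>x\<^sup>c \<partial>\<^sub>i\<close> of the Lie algebra lower monomials.\<close>

lemma mono_less_lower_var:
  assumes "exponent f i > 0" "Poly_Mapping.keys c \<subseteq> {..<i}"
  shows "f - expo i + c \<sqsubset> f"
proof (rule mono_lessI[where k = i])
  have c: "exponent c j = 0" if "j \<ge> i" for j
    using assms(2) that by (force simp: in_keys_iff)
  show "exponent (f - expo i + c) i < exponent f i"
    using assms(1) c by (simp add: lookup_add lookup_minus)
  show "exponent (f - expo i + c) j = exponent f j" if "j > i" for j
    using that c by (simp add: lookup_add lookup_minus lookup_single)
qed

section \<open>Comparing order types\<close>

lemma Field_omega_pow_omega: "Field omega_pow_omega = UNIV"
  by (auto simp: omega_pow_omega_alt Field_def)

lemma Well_order_omega_pow_omega: "Well_order omega_pow_omega"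
proof -
  have "omega_pow_omega - Id = {(f, g). f \<sqsubset> g}"
    by (auto simp: omega_pow_omega_alt)
  moreover have "Linear_order omega_pow_omega"
    unfolding Field_omega_pow_omega linear_order_on_def partial_order_on_def preorder_on_def
    unfolding omega_pow_omega_alt refl_on_def trans_def antisym_def total_on_def
    using mono_less_linear by (auto dest: mono_less_trans mono_less_asym)
  ultimately show ?thesis
    by (simp add: well_order_on_def wf_mono_less)
qed

text \<open>A strictly increasing map does not lower order types: if the target \<open>r'\<close> were isomorphic to
  the proper initial segment of \<open>r\<close> below \<open>a\<close>, the composite \<open>h\<close> of the two maps would satisfy
  \<open>h a < a\<close>, and \<open>a > h a > h (h a) > \<dots>\<close> would descend for ever.\<close>

lemma strict_mono_imp_ordLeq:
  assumes r: "Well_order r" and r': "Well_order r'"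
    and field: "\<And>x. x \<in> Field r \<Longrightarrow> f x \<in> Field r'"
    and mono: "\<And>x y. (x, y) \<in> r \<Longrightarrow> x \<noteq> y \<Longrightarrow> (f x, f y) \<in> r' \<and> f x \<noteq> f y"
  shows "r \<le>o r'"
proof (rule ccontr)
  assume "\<not> r \<le>o r'"
  hence "r' <o r"
    using not_ordLeq_iff_ordLess r r' by blast
  then obtain a where a: "a \<in> Field r" "r' =o Restr r (underS r a)"
    using ordLess_iff_ordIso_Restr[OF r r'] by blast
  then obtain g where g: "iso r' (Restr r (underS r a)) g"
    unfolding ordIso_def by blast
  let ?R = "Restr r (underS r a)"
  define h where "h x = g (f x)" for x
  have inj: "inj_on g (Field r')"
    using g by (auto simp: iso_iff2 bij_betw_def)
  have "g ` Field r' = Field ?R"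
    using g by (auto simp: iso_iff2 bij_betw_def)
  hence under: "h x \<in> underS r a" if "x \<in> Field r" for x
    using field[OF that] Field_Restr_subset[of r "underS r a"] unfolding h_def by blast
  have h_mono: "(h x, h y) \<in> r \<and> h x \<noteq> h y" if "(x, y) \<in> r" "x \<noteq> y" for x y
  proof -
    have "x \<in> Field r" "y \<in> Field r"
      using that by (auto simp: Field_def)
    thus ?thesis
      using mono[OF that] field iso_forward[OF _ g] inj unfolding h_def inj_on_def by blast
  qed
  have "wf (r - Id)"
    using r by (simp add: well_order_on_def)
  moreover have "a \<in> {x \<in> Field r. (h x, x) \<in> r \<and> h x \<noteq> x}"
    using under[OF a(1)] a(1) by (auto simp: underS_def)
  ultimately obtain x where x: "x \<in> {x \<in> Field r. (h x, x) \<in> r \<and> h x \<noteq> x}"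
    and min: "\<And>y. (y, x) \<in> r - Id \<Longrightarrow> y \<notin> {x \<in> Field r. (h x, x) \<in> r \<and> h x \<noteq> x}"
    using wfE_min[of "r - Id" a "{x \<in> Field r. (h x, x) \<in> r \<and> h x \<noteq> x}"] by blast
  have "h x \<in> Field r"
    using x by (auto simp: Field_def)
  thus False
    using x min[of "h x"] h_mono[of "h x" x] by auto
qed

lemma Field_induced_order: "Field (induced_order C) = C"
  by (auto simp: Field_def induced_order_def)

lemma Well_order_induced_order:
  fixes C :: "'p::order set"
  assumes "well_ordered_subset C"
  shows "Well_order (induced_order C)"
proof -
  have "Linear_order (induced_order C)"
    using assms unfolding Field_induced_order linear_order_on_def partial_order_on_def
      preorder_on_def well_ordered_subset_def totally_ordered_def
    by (auto simp: induced_order_def refl_on_def trans_def antisym_def total_on_def)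
  moreover have "wf (induced_order C - Id)"
  proof (rule wfI_min)
    fix x and Q :: "'p set" assume x: "x \<in> Q"
    show "\<exists>z\<in>Q. \<forall>y. (y, z) \<in> induced_order C - Id \<longrightarrow> y \<notin> Q"
    proof (cases "Q \<inter> C = {}")
      case True
      with x show ?thesis
        by (auto simp: induced_order_def)
    next
      case False
      then obtain m where m: "m \<in> Q \<inter> C" "\<forall>d\<in>Q \<inter> C. m \<le> d"
        using assms unfolding well_ordered_subset_def by (metis inf_le2)
      thus ?thesis
        by (intro bexI[of _ m]) (auto simp: induced_order_def intro: antisym)
    qed
  qed
  ultimately show ?thesis
    by (simp add: well_order_on_def)
qed

text \<open>Criterion for uniserial dimension \<open>\<omega>\<^sup>\<omega>\<close>. The second hypothesis makes the order type of every
  segment \<open>{f. f \<sqsubseteq> a}\<close>, hence every ordinal below \<open>\<omega>\<^sup>\<omega>\<close>, the order type of a subset of \<open>S\<close>; a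
  bound strictly below \<open>\<omega>\<^sup>\<omega>\<close> would be isomorphic to some \<open>{f. f \<sqsubset> a}\<close>, which is too short for
  \<open>{f. f \<sqsubseteq> a}\<close>.\<close>

lemma has_udim_omega_pow_omegaI:
  fixes S :: "'p::order set"
  assumes upper: "\<And>C. C \<subseteq> S \<Longrightarrow> well_ordered_subset C \<Longrightarrow>
      \<exists>\<rho>. \<forall>x\<in>C. \<forall>y\<in>C. x < y \<longrightarrow> \<rho> x \<sqsubset> \<rho> y"
    and lower: "\<And>a. \<exists>\<phi>. (\<forall>f. f \<sqsubseteq> a \<longrightarrow> \<phi> f \<in> S)
      \<and> (\<forall>f g. f \<sqsubset> g \<longrightarrow> g \<sqsubseteq> a \<longrightarrow> \<phi> f < \<phi> g)"
  shows "has_udim S omega_pow_omega"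
  unfolding has_udim_def
proof (intro conjI allI impI)
  note W = Well_order_omega_pow_omega
  show "bounds_order_types S omega_pow_omega"
    unfolding bounds_order_types_def
  proof (intro conjI allI impI Well_order_omega_pow_omega)
    fix C assume C: "C \<subseteq> S \<and> well_ordered_subset C"
    then obtain \<rho> where \<rho>: "\<And>x y. x \<in> C \<Longrightarrow> y \<in> C \<Longrightarrow> x < y \<Longrightarrow> \<rho> x \<sqsubset> \<rho> y"
      using upper[of C] by metis
    show "induced_order C \<le>o omega_pow_omega"
    proof (rule strict_mono_imp_ordLeq[where f = \<rho>])
      show "(\<rho> x, \<rho> y) \<in> omega_pow_omega \<and> \<rho> x \<noteq> \<rho> y"
        if "(x, y) \<in> induced_order C" "x \<noteq> y" for x y
      proof -
        have "\<rho> x \<sqsubset> \<rho> y"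
          using that by (intro \<rho>) (auto simp: induced_order_def)
        thus ?thesis
          by (auto simp: omega_pow_omega_alt)
      qed
    qed (use C Well_order_induced_order[of C] W Field_omega_pow_omega in simp_all)
  qed
next
  fix r' :: "(nat \<Rightarrow>\<^sub>0 nat) rel"
  assume r': "bounds_order_types S r'"
  note W = Well_order_omega_pow_omega
  show "omega_pow_omega \<le>o r'"
  proof (rule ccontr)
    assume "\<not> omega_pow_omega \<le>o r'"
    hence "r' <o omega_pow_omega"
      using not_ordLeq_iff_ordLess r' W unfolding bounds_order_types_def by blast
    then obtain a where a: "r' =o Restr omega_pow_omega (underS omega_pow_omega a)"
      using ordLess_iff_ordIso_Restr[OF W] r' unfolding bounds_order_types_def by blast
    obtain \<phi> where \<phi>: "\<And>f. f \<sqsubseteq> a \<Longrightarrow> \<phi> f \<in> S"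
      "\<And>f g. f \<sqsubset> g \<Longrightarrow> g \<sqsubseteq> a \<Longrightarrow> \<phi> f < \<phi> g"
      using lower[of a] by blast
    let ?R = "Restr omega_pow_omega (under omega_pow_omega a)"
    have under: "under omega_pow_omega a = {f. f \<sqsubseteq> a}"
      by (auto simp: under_def omega_pow_omega_alt)
    define C where "C = \<phi> ` {f. f \<sqsubseteq> a}"
    have le: "\<phi> f \<le> \<phi> g" if "f \<sqsubseteq> g" "g \<sqsubseteq> a" for f g
      using \<phi>(2)[of f g] that by (auto intro: less_imp_le)
    have C: "well_ordered_subset C"
      unfolding well_ordered_subset_def
    proof (intro conjI allI impI)
      show "totally_ordered C"
        unfolding totally_ordered_def C_def using mono_less_linear le by blast
    next
      fix D assume D: "D \<subseteq> C \<and> D \<noteq> {}"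
      let ?F = "{f. f \<sqsubseteq> a \<and> \<phi> f \<in> D}"
      obtain d where "d \<in> D" "d \<in> C"
        using D by blast
      hence "?F \<noteq> {}"
        by (auto simp: C_def)
      then obtain m where m: "m \<in> ?F" "\<forall>b\<in>?F. m \<sqsubseteq> b"
        using ex_least_mono[of ?F] by auto
      show "\<exists>m\<in>D. \<forall>d\<in>D. m \<le> d"
      proof (intro bexI[of _ "\<phi> m"] ballI)
        fix d assume d: "d \<in> D"
        hence "d \<in> C"
          using D by blast
        then obtain f where f: "f \<sqsubseteq> a" "d = \<phi> f"
          by (auto simp: C_def)
        thus "\<phi> m \<le> d"
          using m(2) d le[of m f] by simp
      qed (use m(1) in simp)
    qed
    have "?R \<le>o induced_order C"
    proof (rule strict_mono_imp_ordLeq[where f = \<phi>])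
      show "\<phi> x \<in> Field (induced_order C)" if "x \<in> Field ?R" for x
        using that Field_Restr_subset[of omega_pow_omega "under omega_pow_omega a"]
        unfolding Field_induced_order C_def under by blast
      show "(\<phi> x, \<phi> y) \<in> induced_order C \<and> \<phi> x \<noteq> \<phi> y" if "(x, y) \<in> ?R" "x \<noteq> y" for x y
      proof -
        have xy: "x \<sqsubseteq> a" "y \<sqsubseteq> a" "x \<sqsubset> y"
          using that under by (auto simp: omega_pow_omega_alt)
        show ?thesis
          using \<phi>(2)[OF xy(3,2)] xy(1,2) by (auto simp: induced_order_def C_def)
      qed
    qed (use C Well_order_induced_order[of C] Well_order_Restr[OF W] in blast)+
    moreover have "induced_order C \<le>o r'"
    proof -
      have "C \<subseteq> S"
        using \<phi>(1) by (auto simp: C_def)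
      with r' C show ?thesis
        by (simp add: bounds_order_types_def)
    qed
    ultimately have "?R \<le>o Restr omega_pow_omega (underS omega_pow_omega a)"
      using a ordLeq_transitive ordLeq_ordIso_trans by metis
    moreover have "Restr omega_pow_omega (underS omega_pow_omega a) <o ?R"
    proof -
      have "a \<in> under omega_pow_omega a" "a \<notin> underS omega_pow_omega a"
        "underS omega_pow_omega a \<subseteq> under omega_pow_omega a"
        by (auto simp: under_def underS_def omega_pow_omega_alt)
      hence "underS omega_pow_omega a \<subset> under omega_pow_omega a"
        by blast
      moreover have "wo_rel omega_pow_omega"
        using W by (simp add: wo_rel_def)
      ultimately show ?thesis
        using ofilter_subset_ordLess[OF W wo_rel.underS_ofilter wo_rel.under_ofilter] by blast
    qed
    ultimately show False
      using not_ordLess_ordLeq by blast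
  qed
qed

section \<open>Polynomials and partial derivatives\<close>

lemma mpoly_induct [case_names zero single add]:
  fixes p :: "'k::comm_monoid_add mpoly"
  assumes "P 0" "\<And>m c. P (Poly_Mapping.single m c)" "\<And>p q. P p \<Longrightarrow> P q \<Longrightarrow> P (p + q)"
  shows "P p"
proof -
  have "P (\<Sum>m\<in>A. Poly_Mapping.single m (Poly_Mapping.lookup p m))" if "finite A" for A
    using that by (induction rule: finite_induct) (auto intro: assms)
  moreover have "(\<Sum>m\<in>Poly_Mapping.keys p. Poly_Mapping.single m (Poly_Mapping.lookup p m)) = p"
    by (rule poly_mapping_eqI)
      (auto simp: lookup_sum lookup_single when_def sum.delta' in_keys_iff)
  ultimately show ?thesis
    by (metis finite_keys)
qed

lemma lookup_pderiv_var:
  "Poly_Mapping.lookup (pderiv_var i p) m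
    = of_nat (exponent m i + 1) * Poly_Mapping.lookup p (m + expo i)"
proof -
  let ?t = "\<lambda>m'. Poly_Mapping.lookup (Poly_Mapping.single (m' - expo i)
    (of_nat (exponent m' i) * Poly_Mapping.lookup p m')) m"
  have "?t m' = (if m' = m + expo i then of_nat (exponent m i + 1) * Poly_Mapping.lookup p m' else 0)"
    for m'
  proof (cases "exponent m' i = 0 \<or> m' - expo i \<noteq> m")
    case True
    moreover have "exponent (m + expo i) i \<noteq> 0" "m + expo i - expo i = m"
      by (simp_all add: lookup_add)
    ultimately show ?thesis
      by (auto simp: lookup_single)
  next
    case False
    hence "m' = m + expo i"
      using diff_expo_add_expo[of m' i] by auto
    thus ?thesis
      by (simp add: lookup_add)
  qed
  hence "Poly_Mapping.lookup (pderiv_var i p) m = (\<Sum>m'\<in>Poly_Mapping.keys p.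
      if m' = m + expo i then of_nat (exponent m i + 1) * Poly_Mapping.lookup p m' else 0)"
    unfolding pderiv_var_def lookup_sum by simp
  thus ?thesis
    by (simp add: sum.delta in_keys_iff)
qed

lemma pderiv_var_0 [simp]: "pderiv_var i 0 = 0"
  by (rule poly_mapping_eqI) (simp add: lookup_pderiv_var)

lemma pderiv_var_add: "pderiv_var i (p + q) = pderiv_var i p + pderiv_var i q"
  by (rule poly_mapping_eqI) (simp add: lookup_pderiv_var lookup_add algebra_simps)

lemma pderiv_var_diff: "pderiv_var i (p - q) = pderiv_var i p - pderiv_var i q"
  by (rule poly_mapping_eqI) (simp add: lookup_pderiv_var lookup_minus algebra_simps)

lemma pderiv_var_single:
  "pderiv_var i (Poly_Mapping.single m c)
    = Poly_Mapping.single (m - expo i) (of_nat (exponent m i) * c)"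
  by (cases "c = 0") (simp_all add: pderiv_var_def)

lemma pderiv_var_commute: "pderiv_var i (pderiv_var j p) = pderiv_var j (pderiv_var i p)"
  by (rule poly_mapping_eqI)
    (auto simp: lookup_pderiv_var lookup_add lookup_single when_def add.commute add.left_commute)

lemma keys_pderiv_var: "m \<in> Poly_Mapping.keys (pderiv_var i p) \<Longrightarrow> m + expo i \<in> Poly_Mapping.keys p"
  by (auto simp: in_keys_iff lookup_pderiv_var)

lemma pderiv_var_mult: "pderiv_var i (p * q) = pderiv_var i p * q + p * pderiv_var i q"
proof (induction p rule: mpoly_induct)
  case (single m c)
  show ?case
  proof (induction q rule: mpoly_induct)
    case (single m' c')
    have 1: "m + m' - expo i = m - expo i + m'" if "exponent m i > 0"
      by (rule poly_mapping_eqI) (use that in \<open>auto simp: lookup_add lookup_minus lookup_single when_def\<close>)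
    have 2: "m + m' - expo i = m + (m' - expo i)" if "exponent m' i > 0"
      by (rule poly_mapping_eqI) (use that in \<open>auto simp: lookup_add lookup_minus lookup_single when_def\<close>)
    have "Poly_Mapping.single (m + m' - expo i) (of_nat (exponent m i) * c * c')
        = Poly_Mapping.single (m - expo i + m') (of_nat (exponent m i) * c * c')"
      by (cases "exponent m i = 0") (simp_all add: 1)
    moreover have "Poly_Mapping.single (m + m' - expo i) (of_nat (exponent m' i) * c * c')
        = Poly_Mapping.single (m + (m' - expo i)) (of_nat (exponent m' i) * c * c')"
      by (cases "exponent m' i = 0") (simp_all add: 2)
    ultimately show ?case
      by (simp add: mult_single pderiv_var_single lookup_add distrib_right single_add mult.assoc
          mult.left_commute[of c])
  qed (simp_all add: pderiv_var_add algebra_simps)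
qed (simp_all add: pderiv_var_add algebra_simps)

lemma pderiv_var_scale:
  "pderiv_var i (Poly_Mapping.single 0 c * p) = Poly_Mapping.single 0 c * pderiv_var i p"
  by (simp add: pderiv_var_mult pderiv_var_single)

lemma lookup_scale [simp]:
  fixes p :: "'k::comm_ring_1 mpoly"
  shows "Poly_Mapping.lookup (Poly_Mapping.single 0 c * p) m = c * Poly_Mapping.lookup p m"
proof (induction p rule: mpoly_induct)
  case (single m' c')
  thus ?case
    by (simp add: mult_single lookup_single when_def)
qed (simp_all add: algebra_simps lookup_add)

lemma poly_upto_zero [simp]: "0 \<in> poly_upto n"
  by (simp add: poly_upto_def)

lemma poly_upto_single: "Poly_Mapping.keys m \<subseteq> {1..n} \<Longrightarrow> Poly_Mapping.single m c \<in> poly_upto n"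
  by (simp add: poly_upto_def)

lemma poly_upto_add: "p \<in> poly_upto n \<Longrightarrow> q \<in> poly_upto n \<Longrightarrow> p + q \<in> poly_upto n"
  using keys_add[of p q] by (force simp: poly_upto_def)

lemma poly_upto_mult:
  assumes "p \<in> poly_upto n" "q \<in> poly_upto n"
  shows "p * q \<in> poly_upto n"
  unfolding poly_upto_def
proof (intro CollectI ballI)
  fix m assume "m \<in> Poly_Mapping.keys (p * q)"
  then obtain a b where "m = a + b" "a \<in> Poly_Mapping.keys p" "b \<in> Poly_Mapping.keys q"
    using keys_mult[of p q] by blast
  thus "Poly_Mapping.keys m \<subseteq> {1..n}"
    using keys_add[of a b] assms unfolding poly_upto_def by blast
qed

lemma poly_upto_scale: "p \<in> poly_upto n \<Longrightarrow> Poly_Mapping.single 0 c * p \<in> poly_upto n"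
  by (intro poly_upto_mult poly_upto_single) auto

lemma poly_upto_diff: "p \<in> poly_upto n \<Longrightarrow> q \<in> poly_upto n \<Longrightarrow> p - q \<in> poly_upto n"
  using keys_diff[of p q] by (force simp: poly_upto_def)

lemma poly_upto_sum: "(\<And>x. x \<in> A \<Longrightarrow> f x \<in> poly_upto n) \<Longrightarrow> (\<Sum>x\<in>A. f x) \<in> poly_upto n"
  by (induction A rule: infinite_finite_induct) (auto intro: poly_upto_add)

lemma poly_upto_mono: "m \<le> n \<Longrightarrow> poly_upto m \<subseteq> poly_upto n"
  by (fastforce simp: poly_upto_def)

lemma poly_upto_pderiv: 
  assumes "p \<in> poly_upto n"
  shows "pderiv_var i p \<in> poly_upto n"
  unfolding poly_upto_def
proof (intro CollectI ballI)
  fix m assume "m \<in> Poly_Mapping.keys (pderiv_var i p)"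
  hence "Poly_Mapping.keys (m + expo i) \<subseteq> {1..n}"
    using assms keys_pderiv_var unfolding poly_upto_def by blast
  thus "Poly_Mapping.keys m \<subseteq> {1..n}"
    by (auto simp: in_keys_iff lookup_add)
qed

lemma pderiv_var_eq_0:
  assumes "p \<in> poly_upto n" "i > n"
  shows "pderiv_var i p = 0"
proof -
  have "m \<notin> Poly_Mapping.keys (pderiv_var i p)" for m
  proof
    assume "m \<in> Poly_Mapping.keys (pderiv_var i p)"
    from keys_pderiv_var[OF this] have "Poly_Mapping.keys (m + expo i) \<subseteq> {1..n}"
      using assms(1) unfolding poly_upto_def by blast
    moreover have "i \<in> Poly_Mapping.keys (m + expo i)"
      by (simp add: in_keys_iff lookup_add)
    ultimately show False
      using assms(2) by auto
  qed
  hence "Poly_Mapping.keys (pderiv_var i p) = {}"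
    by blast
  thus ?thesis
    by simp
qed

section \<open>Truncated derivations and the Lie algebra axioms\<close>

text \<open>The action of \<open>\<Sum> a\<^sub>i \<partial>\<^sub>i\<close> on polynomials in the variables of index below \<open>k\<close>, where the infinite sum is
  finite. For fixed \<open>k\<close> these operators are honest derivations of the whole polynomial ring, and the
  Jacobi identity at the coefficient \<open>k\<close> is that of commutators of such operators.\<close>

definition der :: "nat \<Rightarrow> (nat \<Rightarrow> 'k::field_char_0 mpoly) \<Rightarrow> 'k mpoly \<Rightarrow> 'k mpoly" where
  "der k a p = (\<Sum>i\<in>{1..<k}. a i * pderiv_var i p)"

lemma u_hat_bracket_eq: "u_hat_bracket a b k = der k a (b k) - der k b (a k)"
  by (simp add: u_hat_bracket_def der_def sum_subtractf)

lemma der_0 [simp]: "der k a 0 = 0"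
  by (simp add: der_def)

lemma der_eq_0: "(\<And>i. i < k \<Longrightarrow> a i = 0) \<Longrightarrow> der k a p = 0"
  by (simp add: der_def)

lemma der_add: "der k a (p + q) = der k a p + der k a q"
  by (simp add: der_def pderiv_var_add sum.distrib algebra_simps)

lemma der_diff: "der k a (p - q) = der k a p - der k a q"
  by (simp add: der_def pderiv_var_diff sum_subtractf algebra_simps)

lemma der_mult: "der k a (p * q) = der k a p * q + p * der k a q"
  by (simp add: der_def pderiv_var_mult sum.distrib sum_distrib_left sum_distrib_right algebra_simps)

lemma der_sum: "der k a (\<Sum>x\<in>A. f x) = (\<Sum>x\<in>A. der k a (f x))"
  by (induction A rule: infinite_finite_induct) (simp_all add: der_add)

lemma der_in_poly_upto:
  assumes "a \<in> u_hat_carrier" "p \<in> poly_upto n"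
  shows "der k a p \<in> poly_upto n"
  unfolding der_def
proof (rule poly_upto_sum)
  fix i assume i: "i \<in> {1..<k}"
  show "a i * pderiv_var i p \<in> poly_upto n"
  proof (cases "i \<le> n")
    case True
    have "a i \<in> poly_upto (i - 1)"
      using assms(1) i by (simp add: u_hat_carrier_def)
    hence "a i \<in> poly_upto n"
      using poly_upto_mono[of "i - 1" n] True by (metis diff_le_self le_trans subsetD)
    thus ?thesis
      using assms(2) by (intro poly_upto_mult poly_upto_pderiv)
  qed (use pderiv_var_eq_0[OF assms(2)] in simp)
qed

lemma der_extend:
  assumes "p \<in> poly_upto n" "n < k" "k \<le> l"
  shows "der l a p = der k a p"
  unfolding der_def
  by (rule sum.mono_neutral_right) (use assms in \<open>auto simp: pderiv_var_eq_0[OF assms(1)]\<close>)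

lemma u_hat_coeff: "a \<in> u_hat_carrier \<Longrightarrow> i \<ge> 1 \<Longrightarrow> a i \<in> poly_upto (i - 1)"
  by (simp add: u_hat_carrier_def)

lemma u_hat_coeff_0: "a \<in> u_hat_carrier \<Longrightarrow> a 0 = 0"
  by (simp add: u_hat_carrier_def)

lemma u_hat_bracket_closed:
  assumes "a \<in> u_hat_carrier" "b \<in> u_hat_carrier"
  shows "u_hat_bracket a b \<in> u_hat_carrier"
  unfolding u_hat_carrier_def
proof (intro CollectI conjI allI impI)
  show "u_hat_bracket a b 0 = 0"
    by (simp add: u_hat_bracket_def)
  show "u_hat_bracket a b k \<in> poly_upto (k - 1)" if "k \<ge> 1" for k
    using assms that unfolding u_hat_bracket_eq
    by (intro poly_upto_diff der_in_poly_upto u_hat_coeff)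
qed

text \<open>The second-order terms of the two composites agree because partial derivatives commute.\<close>

lemma der_bracket:
  assumes a: "a \<in> u_hat_carrier" and b: "b \<in> u_hat_carrier"
  shows "der k (u_hat_bracket a b) p = der k a (der k b p) - der k b (der k a p)"
proof -
  have coeff: "u_hat_bracket a b i = der k a (b i) - der k b (a i)" if "i \<in> {1..<k}" for i
  proof -
    have "der k a (b i) = der i a (b i)" "der k b (a i) = der i b (a i)"
      using that by (auto intro!: der_extend u_hat_coeff a b)
    thus ?thesis
      by (simp add: u_hat_bracket_eq)
  qed
  have expand: "der k a (der k b p) = (\<Sum>i\<in>{1..<k}. der k a (b i) * pderiv_var i p)
      + (\<Sum>i\<in>{1..<k}. \<Sum>j\<in>{1..<k}. b i * a j * pderiv_var j (pderiv_var i p))" for a b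
  proof -
    have "der k a (der k b p) = (\<Sum>i\<in>{1..<k}. der k a (b i * pderiv_var i p))"
      by (subst (2) der_def) (simp add: der_sum)
    also have "\<dots> = (\<Sum>i\<in>{1..<k}. der k a (b i) * pderiv_var i p)
        + (\<Sum>i\<in>{1..<k}. b i * der k a (pderiv_var i p))"
      by (simp add: der_mult sum.distrib)
    also have "(\<Sum>i\<in>{1..<k}. b i * der k a (pderiv_var i p))
        = (\<Sum>i\<in>{1..<k}. \<Sum>j\<in>{1..<k}. b i * a j * pderiv_var j (pderiv_var i p))"
      by (simp add: der_def sum_distrib_left mult.assoc)
    finally show ?thesis .
  qed
  have "(\<Sum>i\<in>{1..<k}. \<Sum>j\<in>{1..<k}. b i * a j * pderiv_var j (pderiv_var i p))
      = (\<Sum>i\<in>{1..<k}. \<Sum>j\<in>{1..<k}. a i * b j * pderiv_var j (pderiv_var i p))"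
    by (subst sum.swap) (simp add: pderiv_var_commute mult.commute)
  hence "der k a (der k b p) - der k b (der k a p)
      = (\<Sum>i\<in>{1..<k}. der k a (b i) * pderiv_var i p) - (\<Sum>i\<in>{1..<k}. der k b (a i) * pderiv_var i p)"
    by (simp add: expand)
  also have "\<dots> = (\<Sum>i\<in>{1..<k}. (der k a (b i) - der k b (a i)) * pderiv_var i p)"
    by (simp add: sum_subtractf left_diff_distrib)
  also have "\<dots> = der k (u_hat_bracket a b) p"
    unfolding der_def[of k "u_hat_bracket a b"] by (rule sum.cong) (simp_all add: coeff)
  finally show ?thesis ..
qed

lemma u_hat_simps [simp]:
  "lcarrier (u_hat T) = u_hat_carrier"
  "lzero (u_hat T) = (\<lambda>_. 0)"
  "ladd (u_hat T) = u_hat_add"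
  "lscale (u_hat T) = u_hat_scale"
  "lbracket (u_hat T) = u_hat_bracket"
  "ltopology (u_hat T) = u_hat_topology"
  by (simp_all add: u_hat_def)

lemma u_hat_zero_closed: "(\<lambda>_. 0) \<in> u_hat_carrier"
  by (simp add: u_hat_carrier_def)

lemma u_hat_add_closed: "a \<in> u_hat_carrier \<Longrightarrow> b \<in> u_hat_carrier \<Longrightarrow> u_hat_add a b \<in> u_hat_carrier"
  by (simp add: u_hat_carrier_def u_hat_add_def poly_upto_add)

lemma u_hat_scale_closed: "a \<in> u_hat_carrier \<Longrightarrow> u_hat_scale c a \<in> u_hat_carrier"
  by (simp add: u_hat_carrier_def u_hat_scale_def poly_upto_scale)

lemma u_hat_bracket_add_left:
  "u_hat_bracket (u_hat_add a b) c = u_hat_add (u_hat_bracket a c) (u_hat_bracket b c)"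
  by (rule ext) (simp add: u_hat_bracket_def u_hat_add_def pderiv_var_add algebra_simps
      flip: sum.distrib)

lemma u_hat_bracket_swap: "u_hat_bracket a b = u_hat_scale (-1) (u_hat_bracket b a)"
  by (rule ext) (simp add: u_hat_bracket_eq u_hat_scale_def single_uminus)

lemma u_hat_bracket_add_right:
  "u_hat_bracket c (u_hat_add a b) = u_hat_add (u_hat_bracket c a) (u_hat_bracket c b)"
  by (rule ext) (simp add: u_hat_bracket_def u_hat_add_def pderiv_var_add algebra_simps
      flip: sum.distrib)

lemma u_hat_bracket_scale_left: "u_hat_bracket (u_hat_scale t a) c = u_hat_scale t (u_hat_bracket a c)"
  by (rule ext) (simp add: u_hat_bracket_def u_hat_scale_def pderiv_var_scale sum_distrib_left
      right_diff_distrib mult.assoc mult.left_commute)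

lemma u_hat_bracket_scale_right: "u_hat_bracket c (u_hat_scale t a) = u_hat_scale t (u_hat_bracket c a)"
  by (rule ext) (simp add: u_hat_bracket_def u_hat_scale_def pderiv_var_scale sum_distrib_left
      right_diff_distrib mult.assoc mult.left_commute)

lemma u_hat_lie_algebra: "lie_algebra (u_hat (T :: 'k::field_char_0 itself))"
proof (unfold_locales, simp_all only: u_hat_simps)
  show "\<exists>y\<in>u_hat_carrier. u_hat_add x y = (\<lambda>_. 0)" if "x \<in> u_hat_carrier"
    for x :: "nat \<Rightarrow> 'k mpoly"
    using that u_hat_scale_closed[of x "-1"]
    by (intro bexI[of _ "u_hat_scale (-1) x"])
      (auto simp: u_hat_add_def u_hat_scale_def single_uminus)
  show "u_hat_add (u_hat_bracket x (u_hat_bracket y z))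
      (u_hat_add (u_hat_bracket y (u_hat_bracket z x)) (u_hat_bracket z (u_hat_bracket x y)))
      = (\<lambda>_. 0)" if "x \<in> u_hat_carrier" "y \<in> u_hat_carrier" "z \<in> u_hat_carrier"
    for x y z :: "nat \<Rightarrow> 'k mpoly"
    by (rule ext) (simp add: that u_hat_add_def u_hat_bracket_eq[of x "u_hat_bracket y z"]
        u_hat_bracket_eq[of y "u_hat_bracket z x"] u_hat_bracket_eq[of z "u_hat_bracket x y"]
        der_bracket, simp add: u_hat_bracket_eq der_diff)
  show "u_hat_bracket x x = (\<lambda>_. 0)" for x :: "nat \<Rightarrow> 'k mpoly"
    by (rule ext) (simp add: u_hat_bracket_eq)
  show "u_hat_scale (c + d) x = u_hat_add (u_hat_scale c x) (u_hat_scale d x)" for c d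
    and x :: "nat \<Rightarrow> 'k mpoly"
    by (rule ext) (simp add: u_hat_add_def u_hat_scale_def single_add algebra_simps)
  show "u_hat_scale c (u_hat_scale d x) = u_hat_scale (c * d) x" for c d
    and x :: "nat \<Rightarrow> 'k mpoly"
    by (rule ext) (simp add: u_hat_scale_def mult_single flip: mult.assoc)
qed (simp_all add: u_hat_zero_closed u_hat_add_closed u_hat_scale_closed u_hat_bracket_closed
    u_hat_bracket_add_left u_hat_bracket_add_right u_hat_bracket_scale_left
    u_hat_bracket_scale_right, simp_all add: u_hat_add_def u_hat_scale_def algebra_simps)

section \<open>Leading terms of elements of ideals\<close>

lemma lookup_monomial_mult:
  fixes p :: "'k::comm_ring_1 mpoly"
  shows "Poly_Mapping.lookup (Poly_Mapping.single c t * p) (m + c) = t * Poly_Mapping.lookup p m"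
proof (induction p rule: mpoly_induct)
  case (single m' c')
  thus ?case
    by (simp add: mult_single lookup_single when_def add.commute[of c])
qed (simp_all add: algebra_simps lookup_add)

lemma keys_monomial_mult:
  fixes p :: "'k::comm_ring_1 mpoly"
  assumes "m \<in> Poly_Mapping.keys (Poly_Mapping.single c t * p)"
  obtains m' where "m = m' + c" "m' \<in> Poly_Mapping.keys p"
  using assms keys_mult[of "Poly_Mapping.single c t" p] add.commute
  by (fastforce split: if_splits)

lemma keys_sumD: "m \<in> Poly_Mapping.keys (\<Sum>i\<in>A. f i) \<Longrightarrow> \<exists>i\<in>A. m \<in> Poly_Mapping.keys (f i)"
  using keys_sum[of f A] by (auto dest: subsetD)

lemma keys_pderiv_var_iff:
  fixes p :: "'k::field_char_0 mpoly"
  shows "m \<in> Poly_Mapping.keys (pderiv_var i p) \<longleftrightarrow> m + expo i \<in> Poly_Mapping.keys p"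
proof -
  have "(of_nat (exponent m i + 1) :: 'k) \<noteq> 0"
    by (metis Suc_eq_plus1 of_nat_neq_0)
  thus ?thesis
    by (simp only: in_keys_iff lookup_pderiv_var mult_eq_0_iff simp_thms)
qed

definition lead_mono :: "'k::zero mpoly \<Rightarrow> (nat \<Rightarrow>\<^sub>0 nat) \<Rightarrow> bool" where
  "lead_mono p b \<longleftrightarrow> b \<in> Poly_Mapping.keys p \<and> (\<forall>m\<in>Poly_Mapping.keys p. m \<sqsubseteq> b)"

lemma ex_lead_mono:
  fixes p :: "'k::ab_group_add mpoly"
  assumes "p \<noteq> 0"
  shows "\<exists>b. lead_mono p b"
proof -
  have "Poly_Mapping.keys p \<noteq> {}"
    using assms by simp
  thus ?thesis
    using ex_greatest_mono[OF finite_keys] unfolding lead_mono_def by blast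
qed

text \<open>The leading term of \<open>\<Sum> a\<^sub>i \<partial>\<^sub>i\<close> is the leading monomial of the first nonzero coefficient.\<close>

definition lead_term :: "(nat \<Rightarrow> 'k::zero mpoly) \<Rightarrow> nat \<Rightarrow> (nat \<Rightarrow>\<^sub>0 nat) \<Rightarrow> bool" where
  "lead_term a n b \<longleftrightarrow> (\<forall>i<n. a i = 0) \<and> lead_mono (a n) b"

lemma lead_term_admissible:
  assumes "a \<in> u_hat_carrier" "lead_term a n b"
  shows "n \<ge> 1" "Poly_Mapping.keys b \<subseteq> {1..<n}"
proof -
  have b: "b \<in> Poly_Mapping.keys (a n)"
    using assms(2) by (simp add: lead_term_def lead_mono_def)
  show n: "n \<ge> 1"
  proof (rule ccontr)
    assume "\<not> n \<ge> 1"
    hence "a n = 0"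
      using u_hat_coeff_0[OF assms(1)] by (simp add: not_le)
    with b show False
      by simp
  qed
  have "Poly_Mapping.keys b \<subseteq> {1..n - 1}"
    using u_hat_coeff[OF assms(1) n] b unfolding poly_upto_def by blast
  thus "Poly_Mapping.keys b \<subseteq> {1..<n}"
    using n by fastforce
qed

lemma ex_lead_term:
  fixes a :: "nat \<Rightarrow> 'k::ab_group_add mpoly"
  assumes "a \<noteq> (\<lambda>_. 0)"
  shows "\<exists>n b. lead_term a n b"
proof -
  define n where "n = (LEAST i. a i \<noteq> 0)"
  obtain i where "a i \<noteq> 0"
    using assms by auto
  hence "a n \<noteq> 0"
    unfolding n_def by (rule LeastI)
  moreover have "a i = 0" if "i < n" for i
    using not_less_Least[of i "\<lambda>i. a i \<noteq> 0"] that unfolding n_def by blast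
  ultimately show ?thesis
    using ex_lead_mono[of "a n"] unfolding lead_term_def by blast
qed

text \<open>The derivation \<open>x\<^sup>b \<partial>\<^sub>n\<close>.\<close>

definition monomial_field :: "nat \<Rightarrow> (nat \<Rightarrow>\<^sub>0 nat) \<Rightarrow> nat \<Rightarrow> 'k::field_char_0 mpoly" where
  "monomial_field n b = (\<lambda>_. 0)(n := Poly_Mapping.single b 1)"

lemma monomial_field_closed:
  assumes "n \<ge> 1" "Poly_Mapping.keys b \<subseteq> {1..<n}"
  shows "monomial_field n b \<in> u_hat_carrier"
proof -
  have "Poly_Mapping.keys b \<subseteq> {1..n - 1}"
    using assms by fastforce
  thus ?thesis
    using assms(1) by (auto simp: monomial_field_def u_hat_carrier_def intro!: poly_upto_single)
qed

lemma lead_term_monomial_field: "lead_term (monomial_field n b :: nat \<Rightarrow> 'k::field_char_0 mpoly) n b"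
  by (simp add: monomial_field_def lead_term_def lead_mono_def)

lemma der_monomial_field:
  "der k (monomial_field n b) p
    = (if 1 \<le> n \<and> n < k then Poly_Mapping.single b 1 * pderiv_var n p else 0)"
proof -
  have "der k (monomial_field n b) p
      = (\<Sum>i\<in>{1..<k}. if i = n then Poly_Mapping.single b 1 * pderiv_var n p else 0)"
    unfolding der_def by (rule sum.cong) (auto simp: monomial_field_def)
  thus ?thesis
    by (simp add: sum.delta)
qed

lemma hat_idealD:
  fixes I :: "(nat \<Rightarrow> 'k::field_char_0 mpoly) set"
  assumes "lie_ideal (u_hat TYPE('k)) I"
  shows "I \<subseteq> u_hat_carrier" "(\<lambda>_. 0) \<in> I"
    "x \<in> I \<Longrightarrow> y \<in> I \<Longrightarrow> u_hat_add x y \<in> I"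
    "x \<in> I \<Longrightarrow> u_hat_scale c x \<in> I"
    "g \<in> u_hat_carrier \<Longrightarrow> x \<in> I \<Longrightarrow> u_hat_bracket g x \<in> I"
  using assms by (auto simp: lie_ideal_def)

lemma hat_ideal_bracket_left:
  assumes "lie_ideal (u_hat TYPE('k::field_char_0)) I" "g \<in> u_hat_carrier" "x \<in> I"
  shows "u_hat_bracket x g \<in> I"
  using hat_idealD(4,5)[OF assms(1)] assms(2,3) u_hat_bracket_swap[of x g] by metis

text \<open>The witness is the bracket with \<open>x\<^sup>c \<partial>\<^sub>k\<close>. Since \<open>k < n\<close>, the other half of the bracket, in which \<open>a\<close>
  differentiates \<open>x\<^sup>c\<close>, is zero: \<open>a\<close> has no components \<open>\<partial>\<^sub>i\<close> with \<open>i < n\<close>.\<close>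

lemma lead_term_step:
  fixes I :: "(nat \<Rightarrow> 'k::field_char_0 mpoly) set"
  assumes I: "lie_ideal (u_hat TYPE('k)) I" and a: "a \<in> I" and lead: "lead_term a n b"
    and k: "exponent b k > 0" and c: "Poly_Mapping.keys c \<subseteq> {1..<k}"
  shows "\<exists>a'\<in>I. lead_term a' n (b - expo k + c)"
proof
  define g where "g = (monomial_field k c :: nat \<Rightarrow> 'k mpoly)"
  have aC: "a \<in> u_hat_carrier"
    using hat_idealD(1)[OF I] a by blast
  have kn: "1 \<le> k" "k < n"
    using lead_term_admissible[OF aC lead] k by (auto simp: in_keys_iff subset_iff)
  have low: "a i = 0" if "i < n" for i
    using lead that by (simp add: lead_term_def)
  show "u_hat_bracket g a \<in> I"
    unfolding g_def by (intro hat_idealD[OF I] monomial_field_closed kn c a)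
  have "u_hat_bracket g a i = 0" if "i < n" for i
    using that low by (simp add: u_hat_bracket_eq der_eq_0)
  moreover have "u_hat_bracket g a n = Poly_Mapping.single c 1 * pderiv_var k (a n)"
    using kn low by (simp add: u_hat_bracket_eq der_eq_0 g_def der_monomial_field)
  moreover have "lead_mono (Poly_Mapping.single c 1 * pderiv_var k (a n)) (b - expo k + c)"
    unfolding lead_mono_def
  proof (intro conjI ballI)
    have "b - expo k \<in> Poly_Mapping.keys (pderiv_var k (a n))"
      using lead k by (simp add: keys_pderiv_var_iff diff_expo_add_expo lead_term_def lead_mono_def)
    thus "b - expo k + c \<in> Poly_Mapping.keys (Poly_Mapping.single c 1 * pderiv_var k (a n))"
      unfolding in_keys_iff lookup_monomial_mult by simp
  next
    fix m assume "m \<in> Poly_Mapping.keys (Poly_Mapping.single c 1 * pderiv_var k (a n))"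
    then obtain m' where m': "m = m' + c" "m' \<in> Poly_Mapping.keys (pderiv_var k (a n))"
      by (rule keys_monomial_mult)
    hence "m' + expo k \<sqsubseteq> b"
      using lead by (simp add: keys_pderiv_var_iff lead_term_def lead_mono_def)
    hence "m' + expo k \<sqsubseteq> b - expo k + expo k"
      using k by (simp only: diff_expo_add_expo)
    thus "m \<sqsubseteq> b - expo k + c"
      unfolding m'(1) mono_less_add_right by simp
  qed
  ultimately show "lead_term (u_hat_bracket g a) n (b - expo k + c)"
    by (simp add: lead_term_def)
qed

text \<open>Let \<open>k\<close> be the last index where \<open>c\<close> and \<open>b\<close> differ. As long as dividing \<open>b\<close> by some variable of
  index at most \<open>k\<close> leaves it above \<open>c\<close>, do so. Otherwise \<open>b\<close> has no variables before \<open>k\<close> and exceeds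
  \<open>c\<close> by one in the variable \<open>k\<close>, so a single step replaces that \<open>x\<^sub>k\<close> by the
  part of \<open>c\<close> before \<open>k\<close>.\<close>

lemma lead_term_below:
  fixes I :: "(nat \<Rightarrow> 'k::field_char_0 mpoly) set"
  assumes I: "lie_ideal (u_hat TYPE('k)) I"
  shows "a \<in> I \<Longrightarrow> lead_term a n b \<Longrightarrow> c \<sqsubseteq> b \<Longrightarrow> Poly_Mapping.keys c \<subseteq> {1..<n}
    \<Longrightarrow> \<exists>a'\<in>I. lead_term a' n c"
proof (induction b arbitrary: a rule: mono_less_induct)
  case (less b)
  show ?case
  proof (cases "c = b")
    case False
    then obtain k where k: "exponent c k < exponent b k" "\<And>j. j > k \<Longrightarrow> exponent c j = exponent b j"
      using less.prems(3) unfolding mono_less_def by blast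
    show ?thesis
    proof (cases "\<exists>j\<le>k. exponent b j > 0 \<and> c \<sqsubset> b - expo j")
      case True
      then obtain j where j: "exponent b j > 0" "c \<sqsubset> b - expo j"
        by blast
      have "b - expo j \<sqsubset> b"
        using mono_less_lower_var[OF j(1), of 0] by simp
      moreover obtain a' where "a' \<in> I" "lead_term a' n (b - expo j)"
        using lead_term_step[OF I less.prems(1,2) j(1), of 0] by auto
      ultimately show ?thesis
        using less.IH less.prems(4) j(2) by blast
    next
      case none: False
      have below: "exponent b j = 0" if "j < k" for j
      proof (rule ccontr)
        assume "exponent b j \<noteq> 0"
        moreover have "c \<sqsubset> b - expo j"
          using k that by (intro mono_lessI[where k = k]) (auto simp: lookup_minus lookup_single)
        ultimately show False
          using none less_imp_le[OF that] by auto
      qed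
      have at: "exponent b k = exponent c k + 1"
      proof (rule ccontr)
        assume "exponent b k \<noteq> exponent c k + 1"
        hence "c \<sqsubset> b - expo k"
          using k by (intro mono_lessI[where k = k]) (auto simp: lookup_minus lookup_single)
        thus False
          using none k(1) by auto
      qed
      \<comment> \<open>Subtraction truncates, and \<open>b / x\<^sub>k\<close> agrees with \<open>c\<close> from \<open>k\<close> on: only the part of \<open>c\<close> before \<open>k\<close> is left.\<close>
      define d where "d = c - (b - expo k)"
      have d: "exponent d j = (if j < k then exponent c j else 0)" for j
        by (cases j k rule: linorder_cases)
          (simp_all add: d_def lookup_minus lookup_single below at k(2))
      have "Poly_Mapping.keys d \<subseteq> {1..<k}"
      proof
        fix j assume "j \<in> Poly_Mapping.keys d"
        hence "j < k" "j \<in> Poly_Mapping.keys c"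
          by (simp_all add: in_keys_iff d split: if_splits)
        thus "j \<in> {1..<k}"
          using less.prems(4) by auto
      qed
      moreover have "b - expo k + d = c"
      proof (rule poly_mapping_eqI)
        fix j
        show "exponent (b - expo k + d) j = exponent c j"
          by (cases j k rule: linorder_cases)
            (simp_all add: lookup_add lookup_minus lookup_single d below at k(2))
      qed
      ultimately show ?thesis
        using lead_term_step[OF I less.prems(1,2), of k d] k(1) by auto
    qed
  qed (use less.prems in blast)
qed

section \<open>A nonzero ideal contains everything beyond its leading terms\<close>

text \<open>Well-founded recursion on the leading monomial \<open>b\<close> of \<open>p\<close>: integrating the leading term of \<open>p\<close> with
  respect to \<open>x\<^sub>n\<close> gives a \<open>q0\<close> whose image under \<open>D\<close> has the same leading term, because the summands
  \<open>D\<^sub>i \<partial>\<^sub>i\<close> with \<open>i > n\<close> lower the exponent of \<open>x\<^sub>i\<close>, which the extra factor \<open>x\<^sub>n\<close> of \<open>q0\<close> cannot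
  make up for. So \<open>p - D q0\<close> is smaller.\<close>

lemma der_surj:
  fixes D :: "nat \<Rightarrow> 'k::field_char_0 mpoly"
  assumes D: "D \<in> u_hat_carrier" "\<And>i. i < n \<Longrightarrow> D i = 0" "D n = 1" and n: "1 \<le> n" "n < j"
    and p: "p \<in> poly_upto (j - 1)"
  shows "\<exists>q\<in>poly_upto (j - 1). der j D q = p"
proof -
  have lead: "\<exists>q\<in>poly_upto (j - 1). der j D q = p"
    if "lead_mono p b" "p \<in> poly_upto (j - 1)" for p b
    using that
  proof (induction b arbitrary: p rule: mono_less_induct)
    case (less b)
    define c where "c = Poly_Mapping.lookup p b"
    define q0 :: "'k mpoly" where
      "q0 = Poly_Mapping.single (b + expo n) (c / of_nat (exponent b n + 1))"
    define R where "R = (\<Sum>i\<in>{n<..<j}. D i * pderiv_var i q0)"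
    have "Poly_Mapping.keys b \<subseteq> {1..j - 1}"
      using less.prems by (auto simp: lead_mono_def poly_upto_def)
    moreover have "Poly_Mapping.keys (b + expo n) \<subseteq> Poly_Mapping.keys b \<union> {n}"
      using keys_add[of b "expo n"] by simp
    ultimately have q0: "q0 \<in> poly_upto (j - 1)"
      unfolding q0_def using n by (intro poly_upto_single) fastforce
    have "pderiv_var n q0 = Poly_Mapping.single b c"
    proof -
      have "(of_nat (exponent b n + 1) :: 'k) \<noteq> 0"
        by (metis Suc_eq_plus1 of_nat_neq_0)
      thus ?thesis
        unfolding q0_def pderiv_var_single by (simp add: lookup_add)
    qed
    moreover have "der j D q0 = pderiv_var n q0 + R"
    proof -
      have "der j D q0 = (\<Sum>i\<in>insert n {n<..<j}. D i * pderiv_var i q0)"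
        unfolding der_def
        by (rule sum.mono_neutral_right) (use n D(2) in auto)
      thus ?thesis
        by (simp add: R_def D(3))
    qed
    ultimately have der_q0: "der j D q0 = Poly_Mapping.single b c + R"
      by simp
    have R: "m \<sqsubset> b" if "m \<in> Poly_Mapping.keys R" for m
    proof -
      obtain i where i: "n < i" "i < j" "m \<in> Poly_Mapping.keys (D i * pderiv_var i q0)"
        using keys_sumD[OF \<open>m \<in> Poly_Mapping.keys R\<close>[unfolded R_def]] by auto
      then obtain u v where m: "m = u + v" and u: "u \<in> Poly_Mapping.keys (D i)"
        and v: "v \<in> Poly_Mapping.keys (pderiv_var i q0)"
        using keys_mult[of "D i" "pderiv_var i q0"] by blast
      have "v + expo i = b + expo n"
        using v by (simp add: keys_pderiv_var_iff q0_def split: if_splits)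
      hence vb: "exponent v l + (1 when i = l) = exponent b l + (1 when n = l)" for l
        by (metis lookup_add lookup_single)
      have "Poly_Mapping.keys u \<subseteq> {1..i - 1}"
        using u_hat_coeff[OF D(1), of i] u i(1) n(1) unfolding poly_upto_def by auto
      hence u0: "exponent u l = 0" if "l \<ge> i" for l
        using that i(1) by (fastforce simp: in_keys_iff)
      show ?thesis
        unfolding m
      proof (rule mono_lessI[where k = i])
        show "exponent (u + v) i < exponent b i"
          using vb[of i] u0[of i] i(1) by (simp add: lookup_add)
        show "exponent (u + v) l = exponent b l" if "l > i" for l
          using vb[of l] u0[of l] i(1) that by (simp add: lookup_add)
      qed
    qed
    define r where "r = p - der j D q0"
    have r_less: "m \<sqsubset> b" if "m \<in> Poly_Mapping.keys r" for m
    proof (cases "m \<in> Poly_Mapping.keys R")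
      case False
      hence nz: "Poly_Mapping.lookup p m - Poly_Mapping.lookup (Poly_Mapping.single b c) m \<noteq> 0"
        using that by (simp add: r_def der_q0 in_keys_iff lookup_minus lookup_add)
      hence "m \<noteq> b"
        by (auto simp: c_def)
      with nz have "m \<in> Poly_Mapping.keys p"
        by (simp add: in_keys_iff lookup_single)
      with \<open>m \<noteq> b\<close> less.prems(1) show ?thesis
        by (auto simp: lead_mono_def)
    qed (rule R)
    have r: "r \<in> poly_upto (j - 1)"
      unfolding r_def by (intro poly_upto_diff der_in_poly_upto less.prems D q0)
    have "\<exists>q\<in>poly_upto (j - 1). der j D q = r"
    proof (cases "r = 0")
      case False
      then obtain b' where b': "lead_mono r b'"
        using ex_lead_mono by blast
      thus ?thesis
        using less.IH[OF _ b' r] r_less by (simp add: lead_mono_def)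
    qed (auto intro!: bexI[of _ 0])
    then obtain q where q: "q \<in> poly_upto (j - 1)" "der j D q = r"
      by blast
    thus ?case
      using q0 by (intro bexI[of _ "q0 + q"]) (auto simp: der_add r_def poly_upto_add)
  qed
  show ?thesis
  proof (cases "p = 0")
    case False
    thus ?thesis
      using ex_lead_mono lead p by blast
  qed (auto intro!: bexI[of _ 0])
qed

text \<open>The equation \<open>[D, c] = d\<close> is triangular: its coefficient \<open>j\<close> asks for a preimage of
  \<open>d\<^sub>j + \<Sum> c\<^sub>i \<partial>\<^sub>i D\<^sub>j\<close> under \<open>D\<close>, where only \<open>c\<^sub>i\<close> with \<open>i < j\<close> occur. So \<open>c\<close> is chosen coefficient by
  coefficient.\<close>

lemma ad_surj:
  fixes D :: "nat \<Rightarrow> 'k::field_char_0 mpoly"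
  assumes D: "D \<in> u_hat_carrier" "\<And>i. i < n \<Longrightarrow> D i = 0" "D n = 1" and n: "1 \<le> n"
    and d: "d \<in> u_hat_from (Suc n)"
  shows "\<exists>c\<in>u_hat_from (Suc n). u_hat_bracket D c = d"
proof -
  define P where "P c j r \<longleftrightarrow> (if j \<le> n then r = 0
      else r \<in> poly_upto (j - 1) \<and> der j D r - der j c (D j) = d j)"
    for c :: "nat \<Rightarrow> 'k mpoly" and j r
  have dC: "d \<in> u_hat_carrier" and d0: "\<And>i. i \<le> n \<Longrightarrow> d i = 0"
    using d by (auto simp: u_hat_from_def)
  have "\<exists>c. \<forall>j. P c j (c j)"
  proof (rule dependent_wf_choice[OF wf_less])
    fix f g :: "nat \<Rightarrow> 'k mpoly" and j r
    assume "\<And>z. (z, j) \<in> {(x, y). x < y} \<Longrightarrow> f z = g z"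
    hence "der j f p = der j g p" for p
      by (simp add: der_def)
    thus "P f j r = P g j r"
      by (simp add: P_def)
  next
    fix j and c :: "nat \<Rightarrow> 'k mpoly"
    assume c: "\<And>i. (i, j) \<in> {(x, y). x < y} \<Longrightarrow> P c i (c i)"
    show "\<exists>r. P c j r"
    proof (cases "j \<le> n")
      case False
      \<comment> \<open>The entries of \<open>c\<close> from \<open>j\<close> on are arbitrary; cutting them off gives an element of the Lie algebra.\<close>
      define c' where "c' i = (if i < j then c i else 0)" for i
      have "c i \<in> poly_upto (i - 1)" if "i < j" for i
        using c[of i] that by (cases "i \<le> n") (simp_all add: P_def)
      moreover have "c' 0 = 0"
        using c[of 0] by (simp add: c'_def P_def)
      ultimately have "c' \<in> u_hat_carrier"
        by (simp add: u_hat_carrier_def c'_def)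
      moreover have "der j c (D j) = der j c' (D j)"
        by (simp add: der_def c'_def)
      moreover have "D j \<in> poly_upto (j - 1)" "d j \<in> poly_upto (j - 1)"
        using False n by (auto intro!: u_hat_coeff D dC)
      ultimately have "d j + der j c (D j) \<in> poly_upto (j - 1)"
        by (simp add: poly_upto_add der_in_poly_upto)
      then obtain r where "r \<in> poly_upto (j - 1)" "der j D r = d j + der j c (D j)"
        using der_surj[OF D n, of j] False by auto
      with False show ?thesis
        by (auto simp: P_def)
    qed (simp add: P_def)
  qed
  then obtain c where c: "\<And>j. P c j (c j)"
    by blast
  have low: "c i = 0" if "i \<le> n" for i
    using c[of i] that by (simp add: P_def)
  have "c i \<in> poly_upto (i - 1)" for i
    using c[of i] by (cases "i \<le> n") (auto simp: P_def)
  hence "c \<in> u_hat_from (Suc n)"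
    using low by (auto simp: u_hat_from_def u_hat_carrier_def)
  moreover have "u_hat_bracket D c j = d j" for j
  proof (cases "j \<le> n")
    case True
    thus ?thesis
      by (simp add: u_hat_bracket_eq low d0 der_eq_0)
  next
    case False
    thus ?thesis
      using c[of j] by (simp add: P_def u_hat_bracket_eq)
  qed
  ultimately show ?thesis
    by blast
qed

text \<open>Lowering the leading monomial to \<open>1\<close> and rescaling puts some \<open>D = \<partial>\<^sub>n + \<dots>\<close> into the ideal.\<close>

lemma u_hat_from_subset_ideal:
  fixes I :: "(nat \<Rightarrow> 'k::field_char_0 mpoly) set"
  assumes I: "lie_ideal (u_hat TYPE('k)) I" and a: "a \<in> I" and lead: "lead_term a n b"
  shows "u_hat_from (Suc n) \<subseteq> I"
proof
  fix d :: "nat \<Rightarrow> 'k mpoly" assume d: "d \<in> u_hat_from (Suc n)"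
  have n: "1 \<le> n"
    using lead_term_admissible[OF _ lead] hat_idealD(1)[OF I] a by blast
  obtain a' where a': "a' \<in> I" "lead_term a' n 0"
    using lead_term_below[OF I a lead, of 0] zero_mono_le[of b] by auto
  define t where "t = Poly_Mapping.lookup (a' n) 0"
  have t: "t \<noteq> 0"
    using a'(2) by (simp add: t_def lead_term_def lead_mono_def in_keys_iff)
  have a'n: "a' n = Poly_Mapping.single 0 t"
  proof (rule poly_mapping_eqI)
    fix m
    show "Poly_Mapping.lookup (a' n) m = Poly_Mapping.lookup (Poly_Mapping.single 0 t) m"
      using a'(2) by (cases "m = 0")
        (auto simp: t_def lead_term_def lead_mono_def in_keys_iff lookup_single)
  qed
  define D where "D = u_hat_scale (1 / t) a'"
  have D: "D \<in> I"
    unfolding D_def by (intro hat_idealD[OF I] a')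
  have DC: "D \<in> u_hat_carrier"
    using hat_idealD(1)[OF I] D by blast
  have "D i = 0" if "i < n" for i
    using a'(2) that by (simp add: D_def u_hat_scale_def lead_term_def)
  moreover have "D n = 1"
    using t by (simp add: D_def u_hat_scale_def a'n mult_single)
  ultimately obtain c where "c \<in> u_hat_from (Suc n)" "u_hat_bracket D c = d"
    using ad_surj[OF DC _ _ n d] by blast
  thus "d \<in> I"
    using hat_ideal_bracket_left[OF I _ D, of c] by (auto simp: u_hat_from_def)
qed

section \<open>The segments\<close>

text \<open>The elements whose leading term is at most \<open>(n, b)\<close>, together with \<open>0\<close>.\<close>

definition segment :: "nat \<Rightarrow> (nat \<Rightarrow>\<^sub>0 nat) \<Rightarrow> (nat \<Rightarrow> 'k::field_char_0 mpoly) set" where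
  "segment n b = {a \<in> u_hat_carrier. (\<forall>i<n. a i = 0) \<and> (\<forall>m\<in>Poly_Mapping.keys (a n). m \<sqsubseteq> b)}"

lemma lead_term_in_segment: "a \<in> u_hat_carrier \<Longrightarrow> lead_term a n b \<Longrightarrow> a \<in> segment n b"
  by (simp add: segment_def lead_term_def lead_mono_def)

lemma lead_term_in_segmentD: "a \<in> segment n b \<Longrightarrow> lead_term a n c \<Longrightarrow> c \<sqsubseteq> b"
  by (auto simp: segment_def lead_term_def lead_mono_def)

lemma segment_mono_level: "n' < n \<Longrightarrow> segment n b \<subseteq> segment n' b'"
  by (auto simp: segment_def)

lemma segment_mono: "b \<sqsubseteq> b' \<Longrightarrow> segment n b \<subseteq> segment n b'"
  using mono_less_trans by (auto simp: segment_def)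

lemma u_hat_from_subset_segment: "u_hat_from (Suc n) \<subseteq> segment n b"
  by (auto simp: u_hat_from_def segment_def)

lemma segment_total: "segment n b \<subseteq> segment n' b' \<or> segment n' b' \<subseteq> segment n b"
  using segment_mono_level segment_mono mono_less_linear
  by (metis linorder_neqE_nat)

text \<open>Gaussian elimination: an element of the segment with leading term \<open>(n, c)\<close> is reduced by a multiple of an
  element of the ideal with the same leading term until its coefficient \<open>n\<close> vanishes.\<close>

lemma segment_subset_ideal:
  fixes I :: "(nat \<Rightarrow> 'k::field_char_0 mpoly) set"
  assumes I: "lie_ideal (u_hat TYPE('k)) I" and a: "a \<in> I" and lead: "lead_term a n b"
  shows "segment n b \<subseteq> I"
proof -
  have from_I: "u_hat_from (Suc n) \<subseteq> I"
    by (rule u_hat_from_subset_ideal[OF I a lead])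
  have zero: "x \<in> I" if "x \<in> u_hat_carrier" "\<forall>i<n. x i = 0" "x n = 0" for x
    using that from_I by (auto simp: u_hat_from_def less_Suc_eq)
  have main: "x \<in> I" if "x \<in> u_hat_carrier" "lead_term x n c" "c \<sqsubseteq> b" for x c
    using that
  proof (induction c arbitrary: x rule: mono_less_induct)
    case (less c)
    obtain y where y: "y \<in> I" "lead_term y n c"
      using lead_term_below[OF I a lead less.prems(3)] lead_term_admissible(2)[OF less.prems(1,2)]
      by blast
    define s where "s = Poly_Mapping.lookup (x n) c / Poly_Mapping.lookup (y n) c"
    define z where "z = u_hat_add x (u_hat_scale (- s) y)"
    have sy: "u_hat_scale s y \<in> I" "u_hat_scale (- s) y \<in> I"
      by (intro hat_idealD[OF I] y)+
    have zC: "z \<in> u_hat_carrier"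
      unfolding z_def using hat_idealD(1)[OF I] sy(2) less.prems(1) by (auto intro: u_hat_add_closed)
    have z_low: "\<forall>i<n. z i = 0"
      using less.prems(2) y(2) by (simp add: z_def u_hat_add_def u_hat_scale_def lead_term_def)
    have z_keys: "m \<sqsubset> c" if m: "m \<in> Poly_Mapping.keys (z n)" for m
    proof -
      have zm: "Poly_Mapping.lookup (z n) m
          = Poly_Mapping.lookup (x n) m - s * Poly_Mapping.lookup (y n) m"
        by (simp add: z_def u_hat_add_def u_hat_scale_def lookup_add)
      have "Poly_Mapping.lookup (y n) c \<noteq> 0"
        using y(2) by (simp add: lead_term_def lead_mono_def in_keys_iff)
      hence "m \<noteq> c"
        using m zm by (auto simp: in_keys_iff s_def)
      moreover have "m \<in> Poly_Mapping.keys (x n) \<or> m \<in> Poly_Mapping.keys (y n)"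
        using m zm by (auto simp: in_keys_iff)
      ultimately show ?thesis
        using less.prems(2) y(2) by (auto simp: lead_term_def lead_mono_def)
    qed
    have "z \<in> I"
    proof (cases "z n = 0")
      case False
      then obtain c' where c': "lead_mono (z n) c'"
        using ex_lead_mono by blast
      hence "c' \<sqsubset> c"
        using z_keys by (simp add: lead_mono_def)
      thus ?thesis
        using less.IH[OF _ zC, of c'] c' z_low less.prems(3) mono_less_trans
        by (auto simp: lead_term_def)
    qed (use zero zC z_low in blast)
    moreover have "x = u_hat_add z (u_hat_scale s y)"
      by (rule ext) (simp add: z_def u_hat_add_def u_hat_scale_def single_uminus)
    ultimately show ?case
      using hat_idealD(3)[OF I] sy(1) by metis
  qed
  show ?thesis
  proof
    fix x :: "nat \<Rightarrow> 'k mpoly" assume x: "x \<in> segment n b"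
    show "x \<in> I"
    proof (cases "x n = 0")
      case False
      then obtain c where "lead_mono (x n) c"
        using ex_lead_mono by blast
      thus ?thesis
        using main[of x c] x by (auto simp: segment_def lead_term_def lead_mono_def)
    qed (use zero x in \<open>simp add: segment_def\<close>)
  qed
qed

lemma der_lowers:
  assumes g: "g \<in> u_hat_carrier" and m: "m \<in> Poly_Mapping.keys (der k g p)"
  shows "\<exists>m'\<in>Poly_Mapping.keys p. m \<sqsubset> m'"
proof -
  obtain i where i: "1 \<le> i" "m \<in> Poly_Mapping.keys (g i * pderiv_var i p)"
    using keys_sumD[OF m[unfolded der_def]] by auto
  then obtain u v where uv: "m = u + v" "u \<in> Poly_Mapping.keys (g i)"
      "v \<in> Poly_Mapping.keys (pderiv_var i p)"
    using keys_mult[of "g i" "pderiv_var i p"] by blast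
  have "Poly_Mapping.keys u \<subseteq> {1..i - 1}"
    using u_hat_coeff[OF g i(1)] uv(2) unfolding poly_upto_def by blast
  hence "Poly_Mapping.keys u \<subseteq> {..<i}"
    using i(1) by fastforce
  hence "v + expo i - expo i + u \<sqsubset> v + expo i"
    by (intro mono_less_lower_var) (simp_all add: lookup_add)
  hence "m \<sqsubset> v + expo i"
    by (simp add: uv(1) add.commute)
  thus ?thesis
    using keys_pderiv_var[OF uv(3)] by blast
qed

text \<open>By \<open>der_lowers\<close>, brackets do not raise leading terms.\<close>

lemma segment_ideal:
  "lie_ideal (u_hat TYPE('k::field_char_0)) (segment n b)"
  unfolding lie_ideal_def u_hat_simps
proof (intro conjI ballI allI)
  show "segment n b \<subseteq> u_hat_carrier" "(\<lambda>_. 0) \<in> segment n b"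
    by (auto simp: segment_def u_hat_zero_closed)
next
  fix x y :: "nat \<Rightarrow> 'k mpoly" assume "x \<in> segment n b" "y \<in> segment n b"
  thus "u_hat_add x y \<in> segment n b"
    using keys_add[of "x n" "y n"] u_hat_add_closed[of x y]
    by (auto simp: segment_def u_hat_add_def)
next
  fix c and x :: "nat \<Rightarrow> 'k mpoly" assume "x \<in> segment n b"
  thus "u_hat_scale c x \<in> segment n b"
    using u_hat_scale_closed[of x c] by (auto simp: segment_def u_hat_scale_def in_keys_iff)
next
  fix g x :: "nat \<Rightarrow> 'k mpoly" assume g: "g \<in> u_hat_carrier" and x: "x \<in> segment n b"
  have low: "x i = 0" if "i < n" for i
    using x that by (simp add: segment_def)
  have "m \<sqsubset> b" if "m \<in> Poly_Mapping.keys (u_hat_bracket g x n)" for m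
  proof -
    have "m \<in> Poly_Mapping.keys (der n g (x n))"
      using that low by (simp add: u_hat_bracket_eq der_eq_0)
    then obtain m' where "m' \<in> Poly_Mapping.keys (x n)" "m \<sqsubset> m'"
      using der_lowers[OF g] by blast
    thus ?thesis
      using x mono_less_trans by (auto simp: segment_def)
  qed
  moreover have "u_hat_bracket g x i = 0" if "i < n" for i
    using that low by (simp add: u_hat_bracket_eq der_eq_0)
  ultimately show "u_hat_bracket g x \<in> segment n b"
    using x g by (auto simp: segment_def u_hat_bracket_closed)
qed

section \<open>The chain of ideals\<close>

lemma hat_ideal_nonzero:
  fixes I :: "(nat \<Rightarrow> 'k::field_char_0 mpoly) set"
  assumes I: "lie_ideal (u_hat TYPE('k)) I" and a: "a \<in> I" "a \<noteq> (\<lambda>_. 0)"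
  obtains n b where "n \<ge> 1" "Poly_Mapping.keys b \<subseteq> {1..<n}" "lead_term a n b" "a \<in> segment n b"
    "segment n b \<subseteq> I"
proof -
  have aC: "a \<in> u_hat_carrier"
    using hat_idealD(1)[OF I] a(1) by blast
  obtain n b where lead: "lead_term a n b"
    using ex_lead_term[OF a(2)] by blast
  show thesis
    by (rule that[OF lead_term_admissible[OF aC lead] lead lead_term_in_segment[OF aC lead]
          segment_subset_ideal[OF I a(1) lead]])
qed

text \<open>Every ideal is a union of segments, and segments are linearly ordered.\<close>

lemma hat_ideals_total:
  fixes I J :: "(nat \<Rightarrow> 'k::field_char_0 mpoly) set"
  assumes I: "lie_ideal (u_hat TYPE('k)) I" and J: "lie_ideal (u_hat TYPE('k)) J"
  shows "I \<subseteq> J \<or> J \<subseteq> I"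
proof (rule disjCI)
  assume "\<not> J \<subseteq> I"
  then obtain a where a: "a \<in> J" "a \<notin> I"
    by blast
  hence "a \<noteq> (\<lambda>_. 0)"
    using hat_idealD(2)[OF I] by auto
  then obtain n b where ab: "a \<in> segment n b" "segment n b \<subseteq> J"
    using hat_ideal_nonzero[OF J a(1)] by metis
  show "I \<subseteq> J"
  proof
    fix x assume x: "x \<in> I"
    show "x \<in> J"
    proof (cases "x = (\<lambda>_. 0)")
      case False
      then obtain n' b' where xb: "x \<in> segment n' b'" "segment n' b' \<subseteq> I"
        using hat_ideal_nonzero[OF I x] by metis
      thus ?thesis
        using segment_total[of n b n' b'] ab a(2) by blast
    qed (use hat_idealD(2)[OF J] in simp)
  qed
qed

lemma ex_segment_0_subset_ideal:
  fixes I :: "(nat \<Rightarrow> 'k::field_char_0 mpoly) set"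
  assumes I: "lie_ideal (u_hat TYPE('k)) I" "I \<noteq> {\<lambda>_. 0}"
  shows "\<exists>n\<ge>1. segment n 0 \<subseteq> I"
proof -
  obtain a where a: "a \<in> I" "a \<noteq> (\<lambda>_. 0)"
    using I hat_idealD(2)[OF I(1)] by blast
  obtain n b where "n \<ge> 1" "segment n b \<subseteq> I"
    using hat_ideal_nonzero[OF I(1) a] by metis
  moreover have "segment n 0 \<subseteq> (segment n b :: (nat \<Rightarrow> 'k mpoly) set)"
    by (rule segment_mono) (use zero_mono_le[of b] in auto)
  ultimately show ?thesis
    by blast
qed

text \<open>For levels \<open>n \<le> N\<close>, the order type of the leading terms \<open>(n, b)\<close> is realised inside \<open>\<omega>\<^sup>\<omega>\<close>: the
  monomials \<open>b\<close> only involve variables below \<open>N\<close>, so the exponent of \<open>N\<close> is free to record the level.\<close>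

definition segment_code :: "nat \<Rightarrow> nat \<Rightarrow> (nat \<Rightarrow>\<^sub>0 nat) \<Rightarrow> (nat \<Rightarrow>\<^sub>0 nat)" where
  "segment_code N n b = b + Poly_Mapping.single N (N - n)"

text \<open>The extra code \<open>single N N\<close> exceeds all codes of segments; it serves the ideal that misses none.\<close>

definition missing_codes :: "nat \<Rightarrow> (nat \<Rightarrow> 'k::field_char_0 mpoly) set \<Rightarrow> (nat \<Rightarrow>\<^sub>0 nat) set" where
  "missing_codes N I = insert (Poly_Mapping.single N N)
    {segment_code N n b |n b. 1 \<le> n \<and> n \<le> N \<and> Poly_Mapping.keys b \<subseteq> {1..<n} \<and> \<not> segment n b \<subseteq> I}"

definition ideal_rank :: "nat \<Rightarrow> (nat \<Rightarrow> 'k::field_char_0 mpoly) set \<Rightarrow> (nat \<Rightarrow>\<^sub>0 nat)" where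
  "ideal_rank N I = (SOME c. c \<in> missing_codes N I \<and> (\<forall>d\<in>missing_codes N I. c \<sqsubseteq> d))"

lemma ideal_rank:
  shows "ideal_rank N I \<in> missing_codes N I" "d \<in> missing_codes N I \<Longrightarrow> ideal_rank N I \<sqsubseteq> d"
proof -
  have "missing_codes N I \<noteq> {}"
    by (simp add: missing_codes_def)
  from someI_ex[OF ex_least_mono[OF this, unfolded Bex_def]]
  show "ideal_rank N I \<in> missing_codes N I" "d \<in> missing_codes N I \<Longrightarrow> ideal_rank N I \<sqsubseteq> d"
    unfolding ideal_rank_def by blast+
qed

lemma exponent_eq_0: "Poly_Mapping.keys f \<subseteq> A \<Longrightarrow> j \<notin> A \<Longrightarrow> exponent f j = 0"
  using in_keys_iff[of j f] by blast

lemma level_mono_less: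
  assumes "Poly_Mapping.keys b \<subseteq> {..<N}" "Poly_Mapping.keys b' \<subseteq> {..<N}" "s < t"
  shows "b + Poly_Mapping.single N s \<sqsubset> b' + Poly_Mapping.single N t"
proof (rule mono_lessI[where k = N])
  have zero: "exponent b j = 0 \<and> exponent b' j = 0" if "j \<ge> N" for j
    using exponent_eq_0[OF assms(1), of j] exponent_eq_0[OF assms(2), of j] that by simp
  show "exponent (b + Poly_Mapping.single N s) N < exponent (b' + Poly_Mapping.single N t) N"
    using zero[of N] assms(3) by (simp add: lookup_add)
  show "exponent (b + Poly_Mapping.single N s) j = exponent (b' + Poly_Mapping.single N t) j"
    if "j > N" for j
    using zero[of j] that by (simp add: lookup_add lookup_single)
qed

text \<open>A segment in \<open>I'\<close> but not in \<open>I\<close> bounds the rank of \<open>I\<close>; every segment missing from \<open>I'\<close>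
  has a larger code. The zero ideal, which lies above no segment, is admitted with rank \<open>0\<close>, so
  that one rank function serves all members of a well-ordered set of ideals.\<close>

lemma ideal_rank_strict_mono:
  fixes I I' :: "(nat \<Rightarrow> 'k::field_char_0 mpoly) set"
  assumes I: "lie_ideal (u_hat TYPE('k)) I" and I': "lie_ideal (u_hat TYPE('k)) I'"
    and sub: "I \<subset> I'" and N: "1 \<le> N" and I0: "I = {\<lambda>_. 0} \<or> segment N 0 \<subseteq> I"
    and I'0: "segment N 0 \<subseteq> I'"
  shows "ideal_rank N I \<sqsubset> ideal_rank N I'"
proof -
  obtain n b where nb: "1 \<le> n" "n \<le> N" "Poly_Mapping.keys b \<subseteq> {1..<n}" "\<not> segment n b \<subseteq> I"
    "segment n b \<subseteq> I'"
  proof (cases "segment N 0 \<subseteq> I")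
    case True
    obtain a where a: "a \<in> I'" "a \<notin> I"
      using sub by blast
    hence "a \<noteq> (\<lambda>_. 0)"
      using hat_idealD(2)[OF I] by auto
    then obtain n b where nb: "n \<ge> 1" "Poly_Mapping.keys b \<subseteq> {1..<n}" "a \<in> segment n b"
      "segment n b \<subseteq> I'"
      using hat_ideal_nonzero[OF I' a(1)] by metis
    moreover have "n \<le> N"
      using segment_mono_level[of N n b 0] nb(3) True a(2) by (metis not_le subsetD)
    ultimately show ?thesis
      using that a(2) by blast
  next
    case False
    thus ?thesis
      using that[of N 0] N I'0 by simp
  qed
  have keys_N: "Poly_Mapping.keys b \<subseteq> {..<N}"
    using nb(2,3) by fastforce
  have "ideal_rank N I \<sqsubseteq> segment_code N n b"
    by (intro ideal_rank) (use nb in \<open>unfold missing_codes_def, blast\<close>)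
  moreover
  have "segment_code N n b \<sqsubset> c" if "c \<in> missing_codes N I'" for c
    using that unfolding missing_codes_def
  proof
    assume "c = Poly_Mapping.single N N"
    thus ?thesis
      using level_mono_less[OF keys_N, of 0 "N - n" N] nb(1,2) N by (simp add: segment_code_def)
  next
    assume "c \<in> {segment_code N n b |n b.
      1 \<le> n \<and> n \<le> N \<and> Poly_Mapping.keys b \<subseteq> {1..<n} \<and> \<not> segment n b \<subseteq> I'}"
    then obtain n' b' where c: "c = segment_code N n' b'" "1 \<le> n'" "n' \<le> N"
      "Poly_Mapping.keys b' \<subseteq> {1..<n'}" "\<not> segment n' b' \<subseteq> I'"
      by blast
    have not_sub: "\<not> segment n' b' \<subseteq> (segment n b :: (nat \<Rightarrow> 'k mpoly) set)"
      using nb(5) c(5) by blast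
    show ?thesis
    proof (cases n n' rule: linorder_cases)
      case less
      thus ?thesis
        using not_sub segment_mono_level by blast
    next
      case equal
      hence "b \<sqsubset> b'"
        using not_sub segment_mono[of b' b n] mono_less_linear[of b b'] by auto
      thus ?thesis
        using equal by (simp add: c(1) segment_code_def)
    next
      case greater
      have "Poly_Mapping.keys b' \<subseteq> {..<N}"
        using c(3,4) by fastforce
      thus ?thesis
        unfolding c(1) segment_code_def using greater nb(2)
        by (intro level_mono_less keys_N) auto
    qed
  qed
  hence "segment_code N n b \<sqsubset> ideal_rank N I'"
    using ideal_rank(1) by blast
  ultimately show ?thesis
    using mono_less_trans by (elim disjE) simp_all
qed

definition ideals_above :: "nat \<Rightarrow> (nat \<Rightarrow> 'k::field_char_0 mpoly) set set" where
  "ideals_above N = {I. lie_ideal (u_hat TYPE('k)) I \<and> u_hat_from N \<subseteq> I}"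

lemma wf_ideals_above:
  assumes "1 \<le> N"
  shows "wf {(I, J). I \<in> ideals_above N \<and> J \<in> ideals_above N \<and> I \<subset> J}"
proof -
  have "segment N 0 \<subseteq> I" if "I \<in> ideals_above N" for I
    using that by (auto simp: ideals_above_def segment_def u_hat_from_def)
  hence "ideal_rank N I \<sqsubset> ideal_rank N J"
    if "I \<in> ideals_above N" "J \<in> ideals_above N" "I \<subset> J" for I J
    using that assms by (intro ideal_rank_strict_mono) (auto simp: ideals_above_def)
  hence "{(I, J). I \<in> ideals_above N \<and> J \<in> ideals_above N \<and> I \<subset> J}
      \<subseteq> inv_image {(f, g). f \<sqsubset> g} (ideal_rank N)"
    by (auto simp: inv_image_def)
  thus ?thesis
    by (rule wf_subset[OF wf_inv_image[OF wf_mono_less]])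
qed

section \<open>Uniserial dimension\<close>

text \<open>Monomials in \<open>x\<^sub>0, x\<^sub>1, \<dots>\<close> as indexed in \<open>omega_pow_omega\<close>, moved to the variables \<open>x\<^sub>1, x\<^sub>2, \<dots>\<close> of
  the Lie algebra.\<close>

definition shift_mono :: "(nat \<Rightarrow>\<^sub>0 nat) \<Rightarrow> (nat \<Rightarrow>\<^sub>0 nat)" where
  "shift_mono f = Abs_poly_mapping (\<lambda>i. case i of 0 \<Rightarrow> 0 | Suc j \<Rightarrow> exponent f j)"

lemma lookup_shift_mono: "exponent (shift_mono f) i = (case i of 0 \<Rightarrow> 0 | Suc j \<Rightarrow> exponent f j)"
proof -
  have "{i. (case i of 0 \<Rightarrow> 0 | Suc j \<Rightarrow> exponent f j) \<noteq> 0} \<subseteq> Suc ` Poly_Mapping.keys f"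
  proof
    fix i assume "i \<in> {i. (case i of 0 \<Rightarrow> 0 | Suc j \<Rightarrow> exponent f j) \<noteq> 0}"
    thus "i \<in> Suc ` Poly_Mapping.keys f"
      by (cases i) (simp_all add: in_keys_iff)
  qed
  hence "finite {i. (case i of 0 \<Rightarrow> 0 | Suc j \<Rightarrow> exponent f j) \<noteq> 0}"
    by (rule finite_subset) simp
  thus ?thesis
    by (simp add: shift_mono_def)
qed

lemma shift_mono_less:
  assumes "f \<sqsubset> g"
  shows "shift_mono f \<sqsubset> shift_mono g"
proof -
  obtain k where k: "exponent f k < exponent g k" "\<And>j. j > k \<Longrightarrow> exponent f j = exponent g j"
    using assms unfolding mono_less_def by blast
  show ?thesis
    by (rule mono_lessI[where k = "Suc k"]) (auto simp: lookup_shift_mono k split: nat.splits)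
qed

lemma keys_shift_mono:
  assumes "Poly_Mapping.keys f \<subseteq> {..<m}"
  shows "Poly_Mapping.keys (shift_mono f) \<subseteq> {1..<Suc m}"
proof
  fix i assume "i \<in> Poly_Mapping.keys (shift_mono f)"
  then obtain j where "i = Suc j" "j \<in> Poly_Mapping.keys f"
    by (auto simp: in_keys_iff lookup_shift_mono split: nat.splits)
  thus "i \<in> {1..<Suc m}"
    using assms by auto
qed

lemma segment_strict_mono:
  assumes "n \<ge> 1" "b \<sqsubset> b'" "Poly_Mapping.keys b' \<subseteq> {1..<n}"
  shows "segment n b \<subset> (segment n b' :: (nat \<Rightarrow> 'k::field_char_0 mpoly) set)"
proof -
  let ?x = "monomial_field n b' :: nat \<Rightarrow> 'k mpoly"
  have "?x \<in> segment n b'"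
    by (intro lead_term_in_segment monomial_field_closed lead_term_monomial_field assms)
  moreover have "?x \<notin> segment n b"
  proof
    assume "?x \<in> segment n b"
    hence "b' \<sqsubseteq> b"
      using lead_term_monomial_field by (rule lead_term_in_segmentD)
    thus False
      using assms(2) mono_less_asym by auto
  qed
  ultimately show ?thesis
    using segment_mono[of b b' n] assms(2) by blast
qed

lemma segment_nonzero:
  assumes "n \<ge> 1"
  shows "segment n b \<noteq> {\<lambda>_. 0 :: 'k::field_char_0 mpoly}"
proof -
  let ?x = "monomial_field n 0 :: nat \<Rightarrow> 'k mpoly"
  have "?x \<in> segment n 0"
    by (rule lead_term_in_segment[OF monomial_field_closed lead_term_monomial_field])
      (use assms in auto)
  moreover have "segment n 0 \<subseteq> (segment n b :: (nat \<Rightarrow> 'k mpoly) set)"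
    by (rule segment_mono) (use zero_mono_le[of b] in auto)
  moreover have "?x n \<noteq> 0"
    by (simp add: monomial_field_def)
  ultimately show ?thesis
    by auto
qed

text \<open>Upper bound: the least nonzero member of a well-ordered set of ideals contains some \<open>segment N 0\<close>, and
  \<open>ideal_rank N\<close> embeds the set. Lower bound: if \<open>a\<close> has exponents only below \<open>m\<close>, then so has every
  \<open>f \<sqsubseteq> a\<close>, and the segments of level \<open>m + 1\<close> realise them all.\<close>

lemma has_udim_u_hat:
  fixes S :: "(nat \<Rightarrow> 'k::field_char_0 mpoly) set set"
  assumes S: "ideals (u_hat TYPE('k)) - {{\<lambda>_. 0}} \<subseteq> S" "S \<subseteq> ideals (u_hat TYPE('k))"
  shows "has_udim S omega_pow_omega"
proof (rule has_udim_omega_pow_omegaI)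
  fix C assume C: "C \<subseteq> S" "well_ordered_subset C"
  have ideal: "lie_ideal (u_hat TYPE('k)) I" if "I \<in> C" for I
    using that C(1) S(2) by (auto simp: ideals_def)
  show "\<exists>\<rho>. \<forall>x\<in>C. \<forall>y\<in>C. x < y \<longrightarrow> \<rho> x \<sqsubset> \<rho> y"
  proof (cases "C - {{\<lambda>_. 0}} = {}")
    case True
    hence "x = y" if "x \<in> C" "y \<in> C" for x y
      using that by blast
    thus ?thesis
      by (metis less_irrefl)
  next
    case False
    then obtain M where M: "M \<in> C - {{\<lambda>_. 0}}" "\<forall>I\<in>C - {{\<lambda>_. 0}}. M \<subseteq> I"
      using C(2) unfolding well_ordered_subset_def by (metis Diff_subset)
    then obtain N where N: "1 \<le> N" "segment N 0 \<subseteq> M"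
      using ex_segment_0_subset_ideal[OF ideal, of M] by blast
    have above: "segment N 0 \<subseteq> I" if "I \<in> C" "I \<noteq> {\<lambda>_. 0}" for I
      using M(2) N(2) that by blast
    have "ideal_rank N x \<sqsubset> ideal_rank N y" if "x \<in> C" "y \<in> C" "x \<subset> y" for x y
    proof -
      have "y \<noteq> {\<lambda>_. 0}"
        using that(3) hat_idealD(2)[OF ideal[OF that(1)]] by blast
      thus ?thesis
        using above that N(1) ideal by (intro ideal_rank_strict_mono) blast+
    qed
    thus ?thesis
      by blast
  qed
next
  fix a :: "nat \<Rightarrow>\<^sub>0 nat"
  obtain m where m: "Poly_Mapping.keys a \<subseteq> {..<m}"
    using finite_nat_iff_bounded[of "Poly_Mapping.keys a"] by auto
  have keys: "Poly_Mapping.keys f \<subseteq> {..<m}" if "f \<sqsubseteq> a" for f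
    using that
  proof
    assume "f \<sqsubset> a"
    then obtain k where k: "exponent f k < exponent a k" "\<And>j. j > k \<Longrightarrow> exponent f j = exponent a j"
      unfolding mono_less_def by blast
    show ?thesis
    proof
      fix j assume j: "j \<in> Poly_Mapping.keys f"
      have "k \<in> Poly_Mapping.keys a"
        using k(1) by (simp add: in_keys_iff)
      hence "k < m"
        using m by auto
      moreover have "j \<in> Poly_Mapping.keys a" if "j > k"
        using j k(2)[OF that] by (simp add: in_keys_iff)
      ultimately show "j \<in> {..<m}"
        using m by (cases "j > k") auto
    qed
  qed (use m in simp)
  let ?\<phi> = "\<lambda>f. segment (Suc m) (shift_mono f) :: (nat \<Rightarrow> 'k mpoly) set"
  have "?\<phi> f \<in> S" for f
    using S(1) segment_ideal[of "Suc m" "shift_mono f"] segment_nonzero[of "Suc m" "shift_mono f"]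
    by (auto simp: ideals_def)
  moreover have "?\<phi> f \<subset> ?\<phi> g" if "f \<sqsubset> g" "g \<sqsubseteq> a" for f g
    by (intro segment_strict_mono shift_mono_less keys_shift_mono keys that) simp
  ultimately show "\<exists>\<phi>. (\<forall>f. f \<sqsubseteq> a \<longrightarrow> \<phi> f \<in> S) \<and> (\<forall>f g. f \<sqsubset> g \<longrightarrow> g \<sqsubseteq> a \<longrightarrow> \<phi> f < \<phi> g)"
    by (intro exI[of _ ?\<phi>]) blast
qed

section \<open>Characteristic ideals\<close>

text \<open>One inclusion holds because the bracket of two elements whose coefficients vanish below \<open>n\<close>
  vanishes up to \<open>n\<close>; the other because \<open>ad \<partial>\<^sub>n\<close> is already onto.\<close>

lemma u_hat_from_Suc_eq_brackets:
  assumes "n \<ge> 1"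
  shows "u_hat_from (Suc n)
    = {u_hat_bracket a b |a b. a \<in> u_hat_from n \<and> b \<in> (u_hat_from n :: (nat \<Rightarrow> 'k::field_char_0 mpoly) set)}"
    (is "_ = ?R")
proof
  show "?R \<subseteq> u_hat_from (Suc n)"
    by (auto simp: u_hat_from_def u_hat_bracket_closed u_hat_bracket_eq less_Suc_eq der_eq_0)
  show "u_hat_from (Suc n) \<subseteq> ?R"
  proof
    fix d :: "nat \<Rightarrow> 'k mpoly" assume d: "d \<in> u_hat_from (Suc n)"
    let ?D = "monomial_field n 0 :: nat \<Rightarrow> 'k mpoly"
    have D: "?D \<in> u_hat_carrier"
      by (rule monomial_field_closed) (use assms in auto)
    have "?D i = 0" if "i < n" for i
      using that by (simp add: monomial_field_def)
    moreover have "?D n = 1"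
      by (simp add: monomial_field_def)
    ultimately obtain c where c: "c \<in> u_hat_from (Suc n)" "u_hat_bracket ?D c = d"
      using ad_surj[OF D _ _ assms d] by blast
    moreover have "?D \<in> u_hat_from n" "c \<in> u_hat_from n"
      using D c(1) by (auto simp: u_hat_from_def monomial_field_def)
    ultimately show "d \<in> ?R"
      by blast
  qed
qed

lemma u_hat_from_characteristic:
  assumes \<sigma>: "lie_automorphism (u_hat TYPE('k::field_char_0)) \<sigma>"
  shows "\<sigma> ` u_hat_from (Suc n) = u_hat_from (Suc n)"
proof (induction n)
  case 0
  have "u_hat_from (Suc 0) = (u_hat_carrier :: (nat \<Rightarrow> 'k mpoly) set)"
    by (auto simp: u_hat_from_def u_hat_carrier_def)
  thus ?case
    using \<sigma> by (simp add: lie_automorphism_def bij_betw_def)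
next
  case (Suc n)
  let ?U = "u_hat_from (Suc n) :: (nat \<Rightarrow> 'k mpoly) set"
  have br: "\<sigma> (u_hat_bracket a b) = u_hat_bracket (\<sigma> a) (\<sigma> b)" if "a \<in> ?U" "b \<in> ?U" for a b
    using \<sigma> that by (auto simp: lie_automorphism_def u_hat_from_def)
  have "\<sigma> ` u_hat_from (Suc (Suc n)) = {\<sigma> (u_hat_bracket a b) |a b. a \<in> ?U \<and> b \<in> ?U}"
    by (subst u_hat_from_Suc_eq_brackets) auto
  also have "\<dots> = {u_hat_bracket (\<sigma> a) (\<sigma> b) |a b. a \<in> ?U \<and> b \<in> ?U}"
    by (rule Collect_cong) (metis br)
  also have "\<dots> = {u_hat_bracket a b |a b. a \<in> \<sigma> ` ?U \<and> b \<in> \<sigma> ` ?U}"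
    by blast
  also have "\<dots> = u_hat_from (Suc (Suc n))"
    unfolding Suc.IH by (rule u_hat_from_Suc_eq_brackets[symmetric]) simp
  finally show ?case .
qed

lemma lie_automorphism_image_ideal:
  assumes \<sigma>: "lie_automorphism G \<sigma>" and I: "lie_ideal G I" and G: "lie_algebra G"
  shows "lie_ideal G (\<sigma> ` I)"
proof -
  interpret lie_algebra G by fact
  have sub: "x \<in> lcarrier G" if "x \<in> I" for x
    using I that by (auto simp: lie_ideal_def)
  have bij: "\<sigma> ` lcarrier G = lcarrier G"
    using \<sigma> by (simp add: lie_automorphism_def bij_betw_def)
  \<comment> \<open>\<open>\<sigma>\<close> preserves brackets, and \<open>0\<close> is one.\<close>
  have zero: "\<sigma> (lzero G) = lzero G"
  proof -
    have "\<sigma> (lzero G) = \<sigma> (lbracket G (lzero G) (lzero G))"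
      using bracket_self[OF zero_closed] by simp
    also have "\<dots> = lbracket G (\<sigma> (lzero G)) (\<sigma> (lzero G))"
      using \<sigma> zero_closed by (simp add: lie_automorphism_def)
    also have "\<dots> = lzero G"
      using bij zero_closed by (intro bracket_self) blast
    finally show ?thesis .
  qed
  show ?thesis
    unfolding lie_ideal_def
  proof (intro conjI ballI allI)
    show "\<sigma> ` I \<subseteq> lcarrier G"
      using bij sub by blast
    show "lzero G \<in> \<sigma> ` I"
      using I zero by (auto simp: lie_ideal_def image_iff intro!: bexI[of _ "lzero G"])
  next
    fix x y assume "x \<in> \<sigma> ` I" "y \<in> \<sigma> ` I"
    then obtain u v where uv: "u \<in> I" "v \<in> I" "x = \<sigma> u" "y = \<sigma> v"
      by blast
    have "ladd G x y = \<sigma> (ladd G u v)"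
      using \<sigma> uv sub by (simp add: lie_automorphism_def)
    moreover have "ladd G u v \<in> I"
      using I uv by (simp add: lie_ideal_def)
    ultimately show "ladd G x y \<in> \<sigma> ` I"
      by simp
  next
    fix c x assume "x \<in> \<sigma> ` I"
    then obtain u where u: "u \<in> I" "x = \<sigma> u"
      by blast
    have "lscale G c x = \<sigma> (lscale G c u)"
      using \<sigma> u sub by (simp add: lie_automorphism_def)
    moreover have "lscale G c u \<in> I"
      using I u by (simp add: lie_ideal_def)
    ultimately show "lscale G c x \<in> \<sigma> ` I"
      by simp
  next
    fix g x assume g: "g \<in> lcarrier G" and "x \<in> \<sigma> ` I"
    then obtain u where u: "u \<in> I" "x = \<sigma> u"
      by blast
    obtain h where h: "h \<in> lcarrier G" "g = \<sigma> h"
      using g bij by blast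
    have "lbracket G g x = \<sigma> (lbracket G h u)"
      using \<sigma> u h sub by (simp add: lie_automorphism_def)
    moreover have "lbracket G h u \<in> I"
      using I u h by (simp add: lie_ideal_def)
    ultimately show "lbracket G g x \<in> \<sigma> ` I"
      by simp
  qed
qed

lemma lie_automorphism_inv:
  assumes \<sigma>: "lie_automorphism G \<sigma>" and G: "lie_algebra G"
  shows "lie_automorphism G (inv_into (lcarrier G) \<sigma>)"
proof -
  interpret lie_algebra G by fact
  let ?\<tau> = "inv_into (lcarrier G) \<sigma>"
  have bij: "bij_betw \<sigma> (lcarrier G) (lcarrier G)"
    using \<sigma> by (simp add: lie_automorphism_def)
  hence \<tau>: "bij_betw ?\<tau> (lcarrier G) (lcarrier G)"
    by (rule bij_betw_inv_into)
  have closed: "?\<tau> x \<in> lcarrier G" if "x \<in> lcarrier G" for x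
    using bij_betwE[OF \<tau>] that by blast
  have right: "\<sigma> (?\<tau> x) = x" if "x \<in> lcarrier G" for x
    using bij_betw_inv_into_right[OF bij that] .
  have left: "?\<tau> z = y" if "y \<in> lcarrier G" "z = \<sigma> y" for y z
    using bij_betw_inv_into_left[OF bij that(1)] that(2) by simp
  show ?thesis
    unfolding lie_automorphism_def
    using \<sigma> \<tau> closed right add_closed scale_closed bracket_closed
    by (auto simp: lie_automorphism_def intro!: left)
qed

text \<open>If \<open>\<sigma>\<close> moved an ideal, there would be a least moved ideal \<open>J\<close> above the fixed ideal \<open>u_hat_from (N + 1)\<close>;
  one of \<open>\<sigma>(J)\<close> and \<open>\<sigma>\<^sup>-\<^sup>1(J)\<close> would be strictly smaller than \<open>J\<close>, hence fixed, hence equal to \<open>J\<close>.\<close>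

lemma hat_ideal_characteristic:
  fixes I :: "(nat \<Rightarrow> 'k::field_char_0 mpoly) set"
  assumes \<sigma>: "lie_automorphism (u_hat TYPE('k)) \<sigma>" and I: "lie_ideal (u_hat TYPE('k)) I"
  shows "\<sigma> ` I = I"
proof (cases "I = {\<lambda>_. 0}")
  case True
  have "lie_ideal (u_hat TYPE('k)) (\<sigma> ` I)"
    by (rule lie_automorphism_image_ideal[OF \<sigma> I u_hat_lie_algebra])
  thus ?thesis
    using hat_idealD(2) True by (metis image_empty image_insert singletonD)
next
  case False
  then obtain N where N: "1 \<le> N" "segment N 0 \<subseteq> I"
    using ex_segment_0_subset_ideal[OF I] by blast
  define F :: "(nat \<Rightarrow> 'k mpoly) set set" where "F = ideals_above (Suc N)"
  note F_def = F_def ideals_above_def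
  have F_image: "\<tau> ` J \<in> F" if "J \<in> F" "lie_automorphism (u_hat TYPE('k)) \<tau>" for J \<tau>
  proof -
    have "\<tau> ` u_hat_from (Suc N) \<subseteq> \<tau> ` J"
      using that(1) by (auto simp: F_def)
    thus ?thesis
      using that u_hat_from_characteristic[OF that(2)]
        lie_automorphism_image_ideal[OF that(2) _ u_hat_lie_algebra]
      by (simp add: F_def)
  qed
  define \<tau> where "\<tau> = inv_into u_hat_carrier \<sigma>"
  have \<tau>: "lie_automorphism (u_hat TYPE('k)) \<tau>"
    using lie_automorphism_inv[OF \<sigma> u_hat_lie_algebra] by (simp add: \<tau>_def)
  have wf: "wf {(I, J). I \<in> F \<and> J \<in> F \<and> I \<subset> J}"
    unfolding F_def(1) by (rule wf_ideals_above) simp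
  have "J \<in> F \<longrightarrow> \<sigma> ` J = J" for J
    using wf
  proof (induction J rule: wf_induct_rule)
    case (less J)
    show ?case
    proof
      assume J: "J \<in> F"
      have JC: "J \<subseteq> u_hat_carrier"
        using J hat_idealD(1)[of J] by (simp add: F_def)
      have bij: "bij_betw \<sigma> u_hat_carrier u_hat_carrier"
        using \<sigma> by (simp add: lie_automorphism_def)
      have \<sigma>\<tau>: "\<sigma> ` \<tau> ` J = J"
        using JC bij by (simp add: \<tau>_def image_inv_into_cancel bij_betw_def)
      have \<tau>\<sigma>: "\<tau> ` \<sigma> ` K = K" if "K \<subseteq> u_hat_carrier" for K
        using that bij by (simp add: \<tau>_def inv_into_image_cancel bij_betw_def)
      have fixed: "\<sigma> ` J' = J'" if "J' \<in> F" "J' \<subset> J" for J'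
        using less[of J'] that J by simp
      have "J \<subseteq> \<sigma> ` J \<or> \<sigma> ` J \<subset> J"
        using hat_ideals_total F_image[OF J \<sigma>] J unfolding F_def by blast
      thus "\<sigma> ` J = J"
      proof
        assume "\<sigma> ` J \<subset> J"
        hence "\<sigma> ` \<sigma> ` J = \<sigma> ` J"
          by (intro fixed F_image J \<sigma>)
        hence "\<tau> ` \<sigma> ` \<sigma> ` J = \<tau> ` \<sigma> ` J"
          by simp
        thus ?thesis
          using \<open>\<sigma> ` J \<subset> J\<close> JC by (simp add: \<tau>\<sigma>)
      next
        assume "J \<subseteq> \<sigma> ` J"
        hence "\<tau> ` J \<subseteq> \<tau> ` \<sigma> ` J"
          by blast
        hence "\<tau> ` J \<subseteq> J"
          using JC by (simp add: \<tau>\<sigma>)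
        show ?thesis
        proof (cases "\<tau> ` J = J")
          case True
          thus ?thesis
            using \<sigma>\<tau> by simp
        next
          case False
          hence "\<sigma> ` \<tau> ` J = \<tau> ` J"
            using \<open>\<tau> ` J \<subseteq> J\<close> by (intro fixed F_image J \<tau>) blast
          thus ?thesis
            using \<sigma>\<tau> by simp
        qed
      qed
    qed
  qed
  moreover have "I \<in> F"
    using I N(2) u_hat_from_subset_segment[of N 0] by (auto simp: F_def)
  ultimately show ?thesis
    by blast
qed

section \<open>Ideals of a quotient\<close>

context lie_algebra
begin

lemma scale_zero:
  assumes x: "x \<in> lcarrier G"
  shows "lscale G 0 x = lzero G"
proof -
  define z where "z = lscale G 0 x"
  have z: "z \<in> lcarrier G" "ladd G z z = z"
    using scale_closed[OF x, of 0] scale_add_left[OF x, of 0 0] by (simp_all add: z_def)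
  obtain y where y: "y \<in> lcarrier G" "ladd G z y = lzero G"
    using add_inverse[OF z(1)] by blast
  have "z = ladd G z (ladd G z y)"
    using add_zero[OF z(1)] y(2) by simp
  also have "\<dots> = ladd G (ladd G z z) y"
    using add_assoc z(1) y(1) by simp
  also have "\<dots> = lzero G"
    using z(2) y(2) by simp
  finally show ?thesis
    by (simp add: z_def)
qed

lemma add_neg:
  assumes x: "x \<in> lcarrier G"
  shows "ladd G x (lscale G (-1) x) = lzero G"
  using scale_add_left[OF x, of 1 "-1"] scale_one[OF x] scale_zero[OF x] by simp

lemma zero_add: "x \<in> lcarrier G \<Longrightarrow> ladd G (lzero G) x = x"
  using add_zero add_commute zero_closed by metis

lemma bracket_swap:
  assumes x: "x \<in> lcarrier G" and y: "y \<in> lcarrier G"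
  shows "lbracket G x y = lscale G (-1) (lbracket G y x)"
proof -
  let ?a = "lbracket G x y" and ?b = "lbracket G y x"
  have ab: "?a \<in> lcarrier G" "?b \<in> lcarrier G"
    by (simp_all add: bracket_closed x y)
  have "lzero G = lbracket G (ladd G x y) (ladd G x y)"
    by (simp add: bracket_self add_closed x y)
  also have "\<dots> = ladd G (ladd G (lbracket G x x) ?b) (ladd G ?a (lbracket G y y))"
    by (simp add: bracket_add_left bracket_add_right add_closed x y)
  also have "\<dots> = ladd G ?a ?b"
    by (simp add: bracket_self zero_add add_zero x y ab add_commute[OF ab(2,1)])
  finally have sum: "ladd G ?a ?b = lzero G" ..
  have "?a = ladd G ?a (ladd G ?b (lscale G (-1) ?b))"
    by (simp add: add_neg ab add_zero)
  also have "\<dots> = ladd G (ladd G ?a ?b) (lscale G (-1) ?b)"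
    by (simp add: add_assoc ab scale_closed)
  finally show ?thesis
    by (simp add: sum zero_add scale_closed ab)
qed

context
  fixes I assumes I: "lie_ideal G I"
begin

lemma ideal_sub: "x \<in> I \<Longrightarrow> x \<in> lcarrier G"
  and ideal_zero: "lzero G \<in> I"
  and ideal_add: "x \<in> I \<Longrightarrow> y \<in> I \<Longrightarrow> ladd G x y \<in> I"
  and ideal_scale: "x \<in> I \<Longrightarrow> lscale G c x \<in> I"
  and ideal_bracket: "g \<in> lcarrier G \<Longrightarrow> x \<in> I \<Longrightarrow> lbracket G g x \<in> I"
  using I by (auto simp: lie_ideal_def)

lemma coset_self: "x \<in> lcarrier G \<Longrightarrow> x \<in> lie_coset G I x"
  unfolding lie_coset_def using ideal_zero add_zero by (metis imageI)

lemma coset_cong: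
  assumes x: "x \<in> lcarrier G" and y: "y \<in> lie_coset G I x"
  shows "lie_coset G I y = lie_coset G I x"
proof -
  obtain i where i: "i \<in> I" "y = ladd G x i"
    using y by (auto simp: lie_coset_def)
  have "ladd G y j \<in> lie_coset G I x" if "j \<in> I" for j
    using that i ideal_sub ideal_add by (simp add: lie_coset_def add_assoc x)
  moreover have "ladd G x j \<in> lie_coset G I y" if j: "j \<in> I" for j
  proof -
    have "ladd G i (ladd G (lscale G (-1) i) j) = j"
      using i(1) j ideal_sub scale_closed by (simp add: add_neg zero_add flip: add_assoc)
    hence "ladd G x j = ladd G y (ladd G (lscale G (-1) i) j)"
      using i j ideal_sub by (simp add: add_assoc x add_closed scale_closed)
    moreover have "ladd G (lscale G (-1) i) j \<in> I"
      by (intro ideal_add ideal_scale i j)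
    ultimately show ?thesis
      by (simp add: lie_coset_def)
  qed
  ultimately show ?thesis
    by (auto simp: lie_coset_def)
qed

lemma coset_zero: "x \<in> I \<Longrightarrow> lie_coset G I x = I"
proof -
  assume x: "x \<in> I"
  have zero: "lie_coset G I (lzero G) = I"
    using zero_add ideal_sub by (force simp: lie_coset_def)
  thus ?thesis
    using coset_cong[OF zero_closed, of x] x by simp
qed

lemma quotient_add:
  assumes x: "x \<in> lcarrier G" and y: "y \<in> lcarrier G"
  shows "ladd (lie_quotient G I) (lie_coset G I x) (lie_coset G I y) = lie_coset G I (ladd G x y)"
proof -
  have "lie_coset G I (ladd G a b) = lie_coset G I (ladd G x y)"
    if a: "a \<in> lie_coset G I x" and b: "b \<in> lie_coset G I y" for a b
  proof (rule coset_cong[OF add_closed[OF x y]])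
    obtain i j where ij: "i \<in> I" "j \<in> I" "a = ladd G x i" "b = ladd G y j"
      using a b by (auto simp: lie_coset_def)
    have C: "i \<in> lcarrier G" "j \<in> lcarrier G"
      using ij ideal_sub by blast+
    have "ladd G a b = ladd G x (ladd G (ladd G i y) j)"
      by (simp add: ij C x y add_assoc add_closed)
    also have "\<dots> = ladd G x (ladd G (ladd G y i) j)"
      by (simp add: add_commute[OF C(1) y])
    also have "\<dots> = ladd G (ladd G x y) (ladd G i j)"
      by (simp add: C x y add_assoc add_closed)
    finally show "ladd G a b \<in> lie_coset G I (ladd G x y)"
      using ideal_add[OF ij(1,2)] by (simp add: lie_coset_def)
  qed
  hence "(\<Union>a\<in>lie_coset G I x. \<Union>b\<in>lie_coset G I y. lie_coset G I (ladd G a b))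
      = (\<Union>a\<in>lie_coset G I x. \<Union>b\<in>lie_coset G I y. lie_coset G I (ladd G x y))"
    by (intro SUP_cong refl)
  also have "\<dots> = lie_coset G I (ladd G x y)"
    using coset_self[OF x] coset_self[OF y] by (auto simp only: UN_constant split: if_splits)
  finally show ?thesis
    by (simp add: lie_quotient_def)
qed

lemma quotient_scale:
  assumes x: "x \<in> lcarrier G"
  shows "lscale (lie_quotient G I) c (lie_coset G I x) = lie_coset G I (lscale G c x)"
proof -
  have "lie_coset G I (lscale G c a) = lie_coset G I (lscale G c x)"
    if a: "a \<in> lie_coset G I x" for a
  proof (rule coset_cong[OF scale_closed[OF x]])
    obtain i where i: "i \<in> I" "a = ladd G x i"
      using a by (auto simp: lie_coset_def)
    thus "lscale G c a \<in> lie_coset G I (lscale G c x)"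
      using ideal_sub ideal_scale by (simp add: scale_add_right x lie_coset_def)
  qed
  hence "(\<Union>a\<in>lie_coset G I x. lie_coset G I (lscale G c a))
      = (\<Union>a\<in>lie_coset G I x. lie_coset G I (lscale G c x))"
    by (intro SUP_cong refl)
  also have "\<dots> = lie_coset G I (lscale G c x)"
    using coset_self[OF x] by (auto simp only: UN_constant split: if_splits)
  finally show ?thesis
    by (simp add: lie_quotient_def)
qed

lemma quotient_bracket:
  assumes x: "x \<in> lcarrier G" and y: "y \<in> lcarrier G"
  shows "lbracket (lie_quotient G I) (lie_coset G I x) (lie_coset G I y)
    = lie_coset G I (lbracket G x y)"
proof -
  have "lie_coset G I (lbracket G a b) = lie_coset G I (lbracket G x y)"
    if a: "a \<in> lie_coset G I x" and b: "b \<in> lie_coset G I y" for a b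
  proof (rule coset_cong[OF bracket_closed[OF x y]])
    obtain i j where ij: "i \<in> I" "j \<in> I" "a = ladd G x i" "b = ladd G y j"
      using a b by (auto simp: lie_coset_def)
    have C: "i \<in> lcarrier G" "j \<in> lcarrier G"
      using ij ideal_sub by blast+
    have ib: "lbracket G i b \<in> I"
      unfolding ij(4) using bracket_swap[OF C(1) add_closed[OF y C(2)]]
      by (simp add: ideal_scale ideal_bracket add_closed y C(2) ij(1))
    have "ladd G (lbracket G x j) (lbracket G i b) \<in> I"
      by (intro ideal_add ib ideal_bracket[OF x] ij)
    moreover have "lbracket G a b
        = ladd G (lbracket G x y) (ladd G (lbracket G x j) (lbracket G i b))"
      by (simp add: ij(3,4) C x y bracket_add_left bracket_add_right[of x] add_assoc add_closed
          bracket_closed)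
    ultimately show "lbracket G a b \<in> lie_coset G I (lbracket G x y)"
      by (simp add: lie_coset_def)
  qed
  hence "(\<Union>a\<in>lie_coset G I x. \<Union>b\<in>lie_coset G I y. lie_coset G I (lbracket G a b))
      = (\<Union>a\<in>lie_coset G I x. \<Union>b\<in>lie_coset G I y. lie_coset G I (lbracket G x y))"
    by (intro SUP_cong refl)
  also have "\<dots> = lie_coset G I (lbracket G x y)"
    using coset_self[OF x] coset_self[OF y] by (auto simp only: UN_constant split: if_splits)
  finally show ?thesis
    by (simp add: lie_quotient_def)
qed

lemma quotient_ideal_preimage:
  assumes Q: "lie_ideal (lie_quotient G I) Q"
  shows "lie_ideal G {x \<in> lcarrier G. lie_coset G I x \<in> Q}"
    and "I \<subseteq> {x \<in> lcarrier G. lie_coset G I x \<in> Q}"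
    and "lie_coset G I ` {x \<in> lcarrier G. lie_coset G I x \<in> Q} = Q"
proof -
  have IQ: "I \<in> Q"
    using Q by (simp add: lie_ideal_def lie_quotient_def)
  show sub: "I \<subseteq> {x \<in> lcarrier G. lie_coset G I x \<in> Q}"
    using IQ coset_zero ideal_sub by auto
  have "Q \<subseteq> lie_coset G I ` lcarrier G"
    using Q by (simp add: lie_ideal_def lie_quotient_def)
  thus "lie_coset G I ` {x \<in> lcarrier G. lie_coset G I x \<in> Q} = Q"
    by blast
  show "lie_ideal G {x \<in> lcarrier G. lie_coset G I x \<in> Q}"
    unfolding lie_ideal_def
  proof (intro conjI ballI allI)
    show "lzero G \<in> {x \<in> lcarrier G. lie_coset G I x \<in> Q}"
      using sub ideal_zero by blast
  next
    fix x y assume "x \<in> {x \<in> lcarrier G. lie_coset G I x \<in> Q}"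
      "y \<in> {x \<in> lcarrier G. lie_coset G I x \<in> Q}"
    thus "ladd G x y \<in> {x \<in> lcarrier G. lie_coset G I x \<in> Q}"
      using Q by (simp add: lie_ideal_def add_closed flip: quotient_add)
  next
    fix c x assume "x \<in> {x \<in> lcarrier G. lie_coset G I x \<in> Q}"
    thus "lscale G c x \<in> {x \<in> lcarrier G. lie_coset G I x \<in> Q}"
      using Q by (simp add: lie_ideal_def scale_closed flip: quotient_scale)
  next
    fix g x assume g: "g \<in> lcarrier G" and x: "x \<in> {x \<in> lcarrier G. lie_coset G I x \<in> Q}"
    have "lie_coset G I g \<in> lcarrier (lie_quotient G I)"
      using g by (simp add: lie_quotient_def)
    thus "lbracket G g x \<in> {x \<in> lcarrier G. lie_coset G I x \<in> Q}"
      using Q g x by (simp add: lie_ideal_def bracket_closed flip: quotient_bracket)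
  qed blast
qed

text \<open>Taking preimages embeds the ideals of the quotient into the ideals above \<open>I\<close>.\<close>

lemma artinian_quotientI:
  assumes "dcc {J. lie_ideal G J \<and> I \<subseteq> J}"
  shows "artinian (lie_quotient G I)"
  unfolding artinian_def dcc_def
proof (intro allI impI)
  fix f assume f: "(\<forall>n. f n \<in> ideals (lie_quotient G I)) \<and> (\<forall>n. f (Suc n) \<subseteq> f n)"
  define p where "p n = {x \<in> lcarrier G. lie_coset G I x \<in> f n}" for n
  have ideal: "lie_ideal (lie_quotient G I) (f n)" for n
    using f by (simp add: ideals_def)
  have "p n \<in> {J. lie_ideal G J \<and> I \<subseteq> J}" for n
    using quotient_ideal_preimage(1,2)[OF ideal[of n]] by (simp add: p_def)
  moreover have "p (Suc n) \<subseteq> p n" for n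
    using f by (auto simp: p_def)
  ultimately obtain N where N: "\<forall>n\<ge>N. p n = p N"
    using assms unfolding dcc_def by meson
  have "f n = lie_coset G I ` p n" for n
    using quotient_ideal_preimage(3)[OF ideal[of n]] by (simp add: p_def)
  thus "\<exists>N. \<forall>n\<ge>N. f n = f N"
    using N by metis
qed

end

end

lemma wf_imp_dcc:
  fixes S :: "'p::order set"
  assumes wf: "wf {(x, y). x \<in> S \<and> y \<in> S \<and> x < y}"
  shows "dcc S"
  unfolding dcc_def
proof (intro allI impI)
  fix f :: "nat \<Rightarrow> 'p" assume f: "(\<forall>n. f n \<in> S) \<and> (\<forall>n. f (Suc n) \<le> f n)"
  obtain z where z: "z \<in> range f"
    "\<And>y. (y, z) \<in> {(x, y). x \<in> S \<and> y \<in> S \<and> x < y} \<Longrightarrow> y \<notin> range f"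
    by (rule wfE_min[OF wf rangeI[of f 0]]) blast
  obtain N where N: "z = f N"
    using z(1) by (rule rangeE)
  have "f n = f N" if "n \<ge> N" for n
  proof -
    have "f n \<le> f N"
      using lift_Suc_antimono_le[of f N n] f that by simp
    thus ?thesis
      using z(2)[of "f n"] f N by (auto simp: order.order_iff_strict)
  qed
  thus "\<exists>N. \<forall>n\<ge>N. f n = f N"
    by blast
qed

lemma artinian_hat_quotient:
  fixes I :: "(nat \<Rightarrow> 'k::field_char_0 mpoly) set"
  assumes I: "lie_ideal (u_hat TYPE('k)) I" "I \<noteq> {\<lambda>_. 0}"
  shows "artinian (lie_quotient (u_hat TYPE('k)) I)"
proof (rule lie_algebra.artinian_quotientI[OF u_hat_lie_algebra I(1)])
  obtain N where N: "1 \<le> N" "segment N 0 \<subseteq> I"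
    using ex_segment_0_subset_ideal[OF I] by blast
  have "{J. lie_ideal (u_hat TYPE('k)) J \<and> I \<subseteq> J} \<subseteq> ideals_above (Suc N)"
    using N(2) u_hat_from_subset_segment[of N 0] by (auto simp: ideals_above_def)
  hence "wf {(J, J'). J \<in> {J. lie_ideal (u_hat TYPE('k)) J \<and> I \<subseteq> J}
      \<and> J' \<in> {J. lie_ideal (u_hat TYPE('k)) J \<and> I \<subseteq> J} \<and> J < J'}"
    by (intro wf_subset[OF wf_ideals_above[of "Suc N"]]) auto
  thus "dcc {J. lie_ideal (u_hat TYPE('k)) J \<and> I \<subseteq> J}"
    by (rule wf_imp_dcc)
qed

section \<open>The topology\<close>

definition cylinder :: "nat \<Rightarrow> (nat \<Rightarrow> 'k::field_char_0 mpoly) \<Rightarrow> (nat \<Rightarrow> 'k mpoly) set" where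
  "cylinder n a = {b \<in> u_hat_carrier. \<forall>i<n. b i = a i}"

lemma u_hat_diff_closed:
  assumes "a \<in> u_hat_carrier" "b \<in> u_hat_carrier"
  shows "(\<lambda>i. b i - a i) \<in> u_hat_carrier"
  using assms by (simp add: u_hat_carrier_def poly_upto_diff)

lemma coset_u_hat_from:
  assumes a: "a \<in> u_hat_carrier"
  shows "u_hat_add a ` u_hat_from n = cylinder n a"
proof
  show "u_hat_add a ` u_hat_from n \<subseteq> cylinder n a"
    using a by (auto simp: u_hat_from_def cylinder_def u_hat_add_closed) (simp add: u_hat_add_def)
  show "cylinder n a \<subseteq> u_hat_add a ` u_hat_from n"
  proof
    fix b assume b: "b \<in> cylinder n a"
    hence "(\<lambda>i. b i - a i) \<in> u_hat_from n"
      using u_hat_diff_closed[OF a] by (simp add: u_hat_from_def cylinder_def)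
    moreover have "b = u_hat_add a (\<lambda>i. b i - a i)"
      by (simp add: u_hat_add_def)
    ultimately show "b \<in> u_hat_add a ` u_hat_from n"
      by blast
  qed
qed

lemma u_hat_basis_eq: "u_hat_basis = {cylinder n a |a n. a \<in> u_hat_carrier \<and> n \<ge> 1}"
  unfolding u_hat_basis_def using coset_u_hat_from by blast

lemma union_of_u_hat_basis_iff:
  "(arbitrary union_of (\<lambda>B. B \<in> u_hat_basis)) U
    \<longleftrightarrow> U \<subseteq> u_hat_carrier \<and> (\<forall>x\<in>U. \<exists>n. cylinder n x \<subseteq> U)"
    (is "?L = ?R")
proof
  assume L: ?L
  have "x \<in> u_hat_carrier \<and> (\<exists>n. cylinder n x \<subseteq> U)" if x: "x \<in> U" for x
  proof -
    obtain n a where na: "x \<in> cylinder n a" "cylinder n a \<subseteq> U"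
      using L x unfolding arbitrary_union_of_alt u_hat_basis_eq by blast
    moreover have "cylinder n x = cylinder n a" "x \<in> u_hat_carrier"
      using na(1) by (simp_all add: cylinder_def)
    ultimately show ?thesis
      by blast
  qed
  thus ?R
    by blast
next
  assume R: ?R
  show ?L
    unfolding arbitrary_union_of_alt
  proof
    fix x assume x: "x \<in> U"
    then obtain n where n: "cylinder n x \<subseteq> U"
      using R by blast
    have "cylinder (Suc n) x \<subseteq> cylinder n x"
      by (auto simp: cylinder_def)
    moreover have xC: "x \<in> u_hat_carrier"
      using R x by blast
    moreover have "cylinder (Suc n) x \<in> u_hat_basis"
      unfolding u_hat_basis_eq using xC by (intro CollectI exI[of _ x] exI[of _ "Suc n"]) simp
    ultimately show "\<exists>V. V \<in> u_hat_basis \<and> x \<in> V \<and> V \<subseteq> U"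
      using n by (intro exI[of _ "cylinder (Suc n) x"]) (auto simp: cylinder_def)
  qed
qed

lemma openin_u_hat:
  "openin u_hat_topology U \<longleftrightarrow> U \<subseteq> u_hat_carrier \<and> (\<forall>x\<in>U. \<exists>n. cylinder n x \<subseteq> U)"
proof -
  have "istopology (arbitrary union_of (\<lambda>B. B \<in> (u_hat_basis :: (nat \<Rightarrow> 'a mpoly) set set)))"
    unfolding istopology_base_alt union_of_u_hat_basis_iff
  proof (intro allI impI conjI ballI)
    fix S T :: "(nat \<Rightarrow> 'a mpoly) set" and x
    assume ST: "(S \<subseteq> u_hat_carrier \<and> (\<forall>x\<in>S. \<exists>n. cylinder n x \<subseteq> S))
      \<and> T \<subseteq> u_hat_carrier \<and> (\<forall>x\<in>T. \<exists>n. cylinder n x \<subseteq> T)" and x: "x \<in> S \<inter> T"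
    then obtain n m where nm: "cylinder n x \<subseteq> S" "cylinder m x \<subseteq> T"
      by blast
    have "cylinder (max n m) x \<subseteq> cylinder n x \<inter> cylinder m x"
      by (auto simp: cylinder_def)
    thus "\<exists>n. cylinder n x \<subseteq> S \<inter> T"
      using nm by blast
  qed blast
  thus ?thesis
    unfolding u_hat_topology_def by (simp add: topology_inverse' union_of_u_hat_basis_iff)
qed

lemma topspace_u_hat: "topspace u_hat_topology = u_hat_carrier"
proof
  show "topspace u_hat_topology \<subseteq> u_hat_carrier"
    using openin_u_hat openin_topspace by blast
  have "openin u_hat_topology u_hat_carrier"
    by (auto simp: openin_u_hat cylinder_def)
  thus "u_hat_carrier \<subseteq> topspace u_hat_topology"
    by (rule openin_subset)
qed

lemma openin_cylinder: "openin u_hat_topology (cylinder n x)"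
  unfolding openin_u_hat
proof (intro conjI ballI exI)
  show "cylinder n y \<subseteq> cylinder n x" if "y \<in> cylinder n x" for y
    using that by (auto simp: cylinder_def)
qed (auto simp: cylinder_def)

text \<open>All operations are continuous for one reason: their coefficients up to a given index depend only on
  the coefficients of the arguments up to that index.\<close>

lemma continuous_map_u_hat:
  fixes f :: "(nat \<Rightarrow> 'k::field_char_0 mpoly) \<Rightarrow> (nat \<Rightarrow> 'k mpoly)"
  assumes closed: "\<And>x. x \<in> u_hat_carrier \<Longrightarrow> f x \<in> u_hat_carrier"
    and local: "\<And>n x x'. (\<And>i. i < n \<Longrightarrow> x' i = x i) \<Longrightarrow> (\<And>i. i < n \<Longrightarrow> f x' i = f x i)"
  shows "continuous_map u_hat_topology u_hat_topology f"
  unfolding continuous_map_def topspace_u_hat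
proof (intro conjI allI impI)
  fix U :: "(nat \<Rightarrow> 'k mpoly) set" assume U: "openin u_hat_topology U"
  show "openin u_hat_topology {x \<in> u_hat_carrier. f x \<in> U}"
    unfolding openin_u_hat
  proof (intro conjI ballI)
    fix x assume x: "x \<in> {x \<in> u_hat_carrier. f x \<in> U}"
    then obtain n where n: "cylinder n (f x) \<subseteq> U"
      using U unfolding openin_u_hat by blast
    have "cylinder n x \<subseteq> {x \<in> u_hat_carrier. f x \<in> U}"
    proof
      fix y assume y: "y \<in> cylinder n x"
      hence "f y \<in> cylinder n (f x)"
        using closed local[of n y x] by (simp add: cylinder_def)
      thus "y \<in> {x \<in> u_hat_carrier. f x \<in> U}"
        using n y by (auto simp: cylinder_def)
    qed
    thus "\<exists>n. cylinder n x \<subseteq> {x \<in> u_hat_carrier. f x \<in> U}"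
      by blast
  qed blast
qed (use closed in blast)

lemma continuous_map_u_hat_prod:
  fixes f :: "(nat \<Rightarrow> 'k::field_char_0 mpoly) \<Rightarrow> (nat \<Rightarrow> 'k mpoly) \<Rightarrow> (nat \<Rightarrow> 'k mpoly)"
  assumes closed: "\<And>x y. x \<in> u_hat_carrier \<Longrightarrow> y \<in> u_hat_carrier \<Longrightarrow> f x y \<in> u_hat_carrier"
    and local: "\<And>n x x' y y'. (\<And>i. i < n \<Longrightarrow> x' i = x i) \<Longrightarrow> (\<And>i. i < n \<Longrightarrow> y' i = y i)
      \<Longrightarrow> (\<And>i. i < n \<Longrightarrow> f x' y' i = f x y i)"
  shows "continuous_map (prod_topology u_hat_topology u_hat_topology) u_hat_topology
    (\<lambda>(x, y). f x y)"
  unfolding continuous_map_def topspace_prod_topology topspace_u_hat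
proof (intro conjI allI impI)
  fix U :: "(nat \<Rightarrow> 'k mpoly) set" assume U: "openin u_hat_topology U"
  let ?W = "{p \<in> u_hat_carrier \<times> u_hat_carrier. (case p of (x, y) \<Rightarrow> f x y) \<in> U}"
  show "openin (prod_topology u_hat_topology u_hat_topology) ?W"
    unfolding openin_prod_topology_alt
  proof (intro allI impI)
    fix x y assume xy: "(x, y) \<in> ?W"
    then obtain n where n: "cylinder n (f x y) \<subseteq> U"
      using U unfolding openin_u_hat by auto
    have "cylinder n x \<times> cylinder n y \<subseteq> ?W"
    proof
      fix p assume "p \<in> cylinder n x \<times> cylinder n y"
      then obtain u v where uv: "p = (u, v)" "u \<in> cylinder n x" "v \<in> cylinder n y"
        by blast
      hence "f u v \<in> cylinder n (f x y)"
        using closed local[of n u x v y] by (simp add: cylinder_def)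
      thus "p \<in> ?W"
        using n uv by (auto simp: cylinder_def)
    qed
    moreover have "x \<in> cylinder n x" "y \<in> cylinder n y"
      using xy by (auto simp: cylinder_def)
    ultimately show "\<exists>A B. openin u_hat_topology A \<and> openin u_hat_topology B \<and> x \<in> A \<and> y \<in> B
        \<and> A \<times> B \<subseteq> ?W"
      using openin_cylinder by blast
  qed
qed (use closed in auto)

lemma u_hat_topological_lie_algebra:
  "topological_lie_algebra (u_hat (T :: 'k::field_char_0 itself))"
  unfolding topological_lie_algebra_def topological_lie_algebra_axioms_def u_hat_simps
proof (intro conjI u_hat_lie_algebra topspace_u_hat allI)
  show "continuous_map (prod_topology u_hat_topology u_hat_topology) u_hat_topology
      (\<lambda>(x, y). u_hat_add x y :: nat \<Rightarrow> 'k mpoly)"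
    by (rule continuous_map_u_hat_prod) (simp_all add: u_hat_add_closed, simp add: u_hat_add_def)
  show "continuous_map u_hat_topology u_hat_topology (u_hat_scale c)" for c :: 'k
    by (rule continuous_map_u_hat) (simp_all add: u_hat_scale_closed, simp add: u_hat_scale_def)
  show "continuous_map (prod_topology u_hat_topology u_hat_topology) u_hat_topology
      (\<lambda>(x, y). u_hat_bracket x y :: nat \<Rightarrow> 'k mpoly)"
    by (rule continuous_map_u_hat_prod)
      (simp_all add: u_hat_bracket_closed, simp add: u_hat_bracket_def)
qed

text \<open>A nonzero ideal contains some \<open>u_hat_from n\<close>, so it is a union of cosets of that open subgroup, and so
  is its complement. Only the zero ideal is closed without being open.\<close>

lemma openin_hat_ideal:
  fixes I :: "(nat \<Rightarrow> 'k::field_char_0 mpoly) set"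
  assumes I: "lie_ideal (u_hat TYPE('k)) I" "I \<noteq> {\<lambda>_. 0}"
  shows "openin u_hat_topology I" "closedin u_hat_topology I"
proof -
  obtain N where "segment N 0 \<subseteq> I"
    using ex_segment_0_subset_ideal[OF I] by blast
  hence N: "u_hat_from (Suc N) \<subseteq> I"
    using u_hat_from_subset_segment[of N 0] by blast
  have diff: "(\<lambda>i. y i - x i) \<in> I" if "x \<in> u_hat_carrier" "y \<in> cylinder (Suc N) x" for x y
    using that N u_hat_diff_closed[of x y] by (auto simp: u_hat_from_def cylinder_def)
  have "cylinder (Suc N) x \<subseteq> I" if x: "x \<in> I" for x
  proof
    fix y assume y: "y \<in> cylinder (Suc N) x"
    have "y = u_hat_add x (\<lambda>i. y i - x i)"
      by (simp add: u_hat_add_def)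
    thus "y \<in> I"
      using hat_idealD(3)[OF I(1) x diff[OF _ y]] hat_idealD(1)[OF I(1)] x by auto
  qed
  thus "openin u_hat_topology I"
    using hat_idealD(1)[OF I(1)] by (auto simp: openin_u_hat)
  have "cylinder (Suc N) x \<subseteq> u_hat_carrier - I" if x: "x \<in> u_hat_carrier - I" for x
  proof
    fix y assume y: "y \<in> cylinder (Suc N) x"
    have "x = u_hat_add y (u_hat_scale (-1) (\<lambda>i. y i - x i))"
      by (simp add: u_hat_add_def u_hat_scale_def single_uminus)
    hence "y \<notin> I"
      using hat_idealD(3)[OF I(1) _ hat_idealD(4)[OF I(1) diff[OF _ y]], of y "-1"] x by auto
    thus "y \<in> u_hat_carrier - I"
      using y by (simp add: cylinder_def)
  qed
  thus "closedin u_hat_topology I"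
    using hat_idealD(1)[OF I(1)] by (auto simp: closedin_def topspace_u_hat openin_u_hat)
qed

lemma closedin_zero: "closedin u_hat_topology {\<lambda>_. 0 :: 'k::field_char_0 mpoly}"
proof -
  have "\<exists>n. cylinder n x \<subseteq> u_hat_carrier - {\<lambda>_. 0}" if "x \<noteq> (\<lambda>_. 0)" for x :: "nat \<Rightarrow> 'k mpoly"
  proof -
    obtain i where "x i \<noteq> 0"
      using \<open>x \<noteq> (\<lambda>_. 0)\<close> by (auto simp: fun_eq_iff)
    thus ?thesis
      by (intro exI[of _ "Suc i"]) (auto simp: cylinder_def)
  qed
  thus ?thesis
    by (auto simp: closedin_def topspace_u_hat openin_u_hat u_hat_zero_closed)
qed

lemma not_openin_zero: "\<not> openin u_hat_topology {\<lambda>_. 0 :: 'k::field_char_0 mpoly}"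
proof
  assume "openin u_hat_topology {\<lambda>_. 0 :: 'k mpoly}"
  then obtain n where n: "cylinder n (\<lambda>_. 0) \<subseteq> {\<lambda>_. 0 :: 'k mpoly}"
    by (auto simp: openin_u_hat)
  let ?x = "monomial_field (Suc n) 0 :: nat \<Rightarrow> 'k mpoly"
  have "?x \<in> cylinder n (\<lambda>_. 0)"
    using monomial_field_closed[of "Suc n" 0] by (simp add: cylinder_def) (simp add: monomial_field_def)
  moreover have "?x (Suc n) \<noteq> 0"
    by (simp add: monomial_field_def)
  ultimately show False
    using n by auto
qed

lemma closed_ideals_u_hat: "closed_ideals (u_hat TYPE('k::field_char_0)) = ideals (u_hat TYPE('k))"
  using openin_hat_ideal(2) closedin_zero by (auto simp: closed_ideals_def ideals_def)

lemma open_ideals_u_hat: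
  "open_ideals (u_hat TYPE('k::field_char_0)) = ideals (u_hat TYPE('k)) - {{\<lambda>_. 0}}"
  using openin_hat_ideal(1) not_openin_zero by (auto simp: open_ideals_def ideals_def)

section \<open>Failure of the chain conditions\<close>

lemma not_dcc_hat_ideals:
  fixes S :: "(nat \<Rightarrow> 'k::field_char_0 mpoly) set set"
  assumes "ideals (u_hat TYPE('k)) - {{\<lambda>_. 0}} \<subseteq> S"
  shows "\<not> dcc S"
proof
  assume dcc: "dcc S"
  let ?f = "\<lambda>n. segment (Suc n) 0 :: (nat \<Rightarrow> 'k mpoly) set"
  have "?f n \<in> S" for n
    using assms segment_ideal[of "Suc n" 0] segment_nonzero[of "Suc n" 0] by (auto simp: ideals_def)
  moreover have "?f (Suc n) \<subseteq> ?f n" for n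
    by (rule segment_mono_level) simp
  ultimately obtain N where N: "\<forall>n\<ge>N. ?f n = ?f N"
    using dcc unfolding dcc_def by meson
  let ?x = "monomial_field (Suc N) 0 :: nat \<Rightarrow> 'k mpoly"
  have "?x \<in> ?f N"
    by (rule lead_term_in_segment[OF monomial_field_closed lead_term_monomial_field]) auto
  moreover have "?x \<notin> ?f (Suc N)"
    by (auto simp: segment_def monomial_field_def)
  ultimately show False
    using N[rule_format, of "Suc N"] by simp
qed

lemma not_acc_hat_ideals:
  fixes S :: "(nat \<Rightarrow> 'k::field_char_0 mpoly) set set"
  assumes "ideals (u_hat TYPE('k)) - {{\<lambda>_. 0}} \<subseteq> S"
  shows "\<not> acc S"
proof
  assume acc: "acc S"
  let ?f = "\<lambda>n. segment 2 (Poly_Mapping.single 1 n) :: (nat \<Rightarrow> 'k mpoly) set"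
  have "?f n \<in> S" for n
    using assms segment_ideal[of 2 "Poly_Mapping.single 1 n"]
      segment_nonzero[of 2 "Poly_Mapping.single 1 n"] by (auto simp: ideals_def)
  moreover have less: "?f n \<subset> ?f (Suc n)" for n
    by (rule segment_strict_mono)
      (auto intro!: mono_lessI[where k = 1] simp: lookup_single)
  ultimately obtain N where N: "\<forall>n\<ge>N. ?f n = ?f N"
    using acc unfolding acc_def by (meson psubset_imp_subset)
  thus False
    using less[of N] by (metis le_SucI order_refl psubset_eq)
qed

theorem corollary7p3:
  shows
    "(topological_lie_algebra (u_hat TYPE('k::field_char_0))
      \<and> open_uniserial (u_hat TYPE('k))
      \<and> closed_uniserial (u_hat TYPE('k))
      \<and> open_almost_artinian (u_hat TYPE('k))
      \<and> closed_almost_artinian (u_hat TYPE('k))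
      \<and> \<not> open_artinian (u_hat TYPE('k))
      \<and> \<not> closed_artinian (u_hat TYPE('k))
      \<and> \<not> open_noetherian (u_hat TYPE('k))
      \<and> \<not> closed_noetherian (u_hat TYPE('k)))
     \<and> (has_udim (open_ideals (u_hat TYPE('k))) omega_pow_omega
      \<and> has_udim (closed_ideals (u_hat TYPE('k))) omega_pow_omega
      \<and> has_udim (ideals (u_hat TYPE('k))) omega_pow_omega)
     \<and> ((\<forall>I \<in> open_ideals (u_hat TYPE('k)). topologically_characteristic (u_hat TYPE('k)) I)
      \<and> (\<forall>I \<in> closed_ideals (u_hat TYPE('k)). topologically_characteristic (u_hat TYPE('k)) I))"
proof -
  let ?A = "ideals (u_hat TYPE('k))" and ?A' = "ideals (u_hat TYPE('k)) - {{\<lambda>_. 0}}"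
  have "totally_ordered ?A"
    using hat_ideals_total by (auto simp: totally_ordered_def ideals_def)
  moreover from this have "totally_ordered ?A'"
    by (simp add: totally_ordered_def)
  moreover have "artinian (lie_quotient (u_hat TYPE('k)) I)" if "I \<in> ?A" "I \<noteq> {\<lambda>_. 0}" for I
    using that artinian_hat_quotient by (simp add: ideals_def)
  moreover have "\<not> dcc ?A" "\<not> dcc ?A'" "\<not> acc ?A" "\<not> acc ?A'"
    by (intro not_dcc_hat_ideals not_acc_hat_ideals; blast)+
  moreover have "has_udim ?A omega_pow_omega" "has_udim ?A' omega_pow_omega"
    by (intro has_udim_u_hat; blast)+
  moreover have "topologically_characteristic (u_hat TYPE('k)) I" if "I \<in> ?A" for I
    using that hat_ideal_characteristic by (auto simp: topologically_characteristic_def ideals_def)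
  ultimately show ?thesis
    unfolding open_uniserial_def closed_uniserial_def open_almost_artinian_def
      closed_almost_artinian_def open_artinian_def closed_artinian_def open_noetherian_def
      closed_noetherian_def open_ideals_u_hat closed_ideals_u_hat u_hat_simps
    using u_hat_topological_lie_algebra by (intro conjI ballI impI) auto
qed

end
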